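(* In the run setting described in the context, for every term $t$ and every $i\in\{0,\dots,n\}$, if $\sigma(T_i)\vdash_{dy}t$, then there is a typed normal $\vdash_{dy}$ proof of $\sigma(T_i)\vdash t$.
   Context: Terms. Fix disjoint sets $\mathscr N$ of names and $\mathscr V$ of variables; $\mathscr V$ contains a subset $\mathscr V_q$ of quantified variables and $\mathscr V_i=\mathscr V\setminus\mathscr V_q$. Terms: $t::=x\mid m\mid\mathsf f(t_1,\dots,t_n)$ ($x\in\mathscr V$, $m\in\mathscr N$, $\mathsf f$ an $n$-ary operator, including a public-key operator $\mathit{pk}$). $\mathsf{st}$ denotes subterms, $\mathsf{vars}$ variables. Substitutions are finite partial maps from variables to terms (identity outside their domain); $\lambda\lambda'$ denotes composition applying $\lambda'$ first. Term derivability $X\vdash_{dy}t$: axiom rule ($X\vdash t$ if $t\in X$), constructor rules (from $X\vdash t_1,\dots,X\vdash t_n$ infer $X\vdash\mathsf f(t_1,\dots,t_n)$), destructor rules (from $X\vdash\mathsf f(t_1,\dots,t_n)$, the major premise, and $X\vdash u_1,\dots,X\vdash u_m$ infer $X\vdash t_i$), the axiom counting as a destructor; a proof is normal if no constructor conclusion is the major premise of a destructor; every proof is assumed convertible to a normal one, normal proofs of $X\vdash t$ contain only terms in $\mathsf{st}(X\cup\{t\})$ (in $\mathsf{st}(X)$ if ending in a destructor), and $\vdash_{dy}$ is polynomial-time decidable. Positions: $\mathrm{pos}(t)$, $t|_p$, $\mathrm{pos}_r(t)$, $t[P\mapsto r]$ as usual; $\mathbb A(S,t)=\{p\in\mathrm{pos}(t):S\vdash_{dy}t|_q\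 \forall q\in Q_p\}$ with $Q_p=\{\varepsilon\}\cup\{qi\in\mathrm{pos}(t): q\text{ a proper prefix of }p\}$. Assertions: $\alpha::=t\doteq u\mid P(u_1,\dots,u_m)\mid t_0\twoheadleftarrow[t_1,\dots,t_n]\mid\alpha_0\wedge\alpha_1\mid\exists x.\alpha\mid\mathit{pk}(k)\ \mathit{says}\ \alpha$ ($u_i,t_0\in\mathscr N\cup\mathscr V$, $t_1,\dots,t_n\in\mathscr N$, $x\in\mathscr V_q$); atomic means not a conjunction or existential; $\mathrm{fv},\mathrm{bv}$ free/bound variables; $\mathsf{pubs}(\alpha)$ = maximal subterms of $\alpha$ containing no variable of $\mathscr V_q$. Term positions of assertions: $\mathrm{pos}(t\doteq t')=0\cdot\mathrm{pos}(t)\cup1\cdot\mathrm{pos}(t')$; $\mathrm{pos}(P(u_0,\dots,u_m))=\{0,\dots,m\}$; $\mathrm{pos}(t\twoheadleftarrow[t_1..t_n])=\{0,\dots,n\}$; $\mathrm{pos}(\alpha\wedge\beta)=0\cdot\mathrm{pos}(\alpha)\cup1\cdot\mathrm{pos}(\beta)$; $\mathrm{pos}(\exists x.\alpha)=0\cdot\mathrm{pos}(\alpha)$; $\mathrm{pos}(\mathit{pk}(k)\ \mathit{says}\ \alpha)=\{0,00\}\cup1\cdot\mathrm{pos}(\alpha)$. Abstractable positions: $\mathbb A(S,t_0\doteq t_1)=\{ip:p\in\mathbb A(S,t_i)\}$; $\mathbb A(S,P(u_1..u_m))=\{i:S\vdash_{dy}u_i\}$; $\mathbb A(S,t\twoheadleftarrow[\dots])=\{0\}$;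 $\mathbb A(S,\alpha_0\wedge\alpha_1)=\{ip:p\in\mathbb A(S,\alpha_i)\}$; $\mathbb A(S,\exists x.\alpha)=\{0p:p\in\mathbb A(S\cup\{x\},\alpha)\}$; $\mathbb A(S,\mathit{pk}(k)\ \mathit{says}\ \alpha)=\{0\}\cup\{1p:p\in\mathbb A(S,\alpha)\}$. Assertion derivability $S;A\vdash_a\alpha$: rules (ax) $S;A\cup\{\alpha\}\vdash\alpha$; (eq) from $S\vdash_{dy}t$ infer $t\doteq t$; (cons) from $t_j\doteq u_j$ ($j\le r$) infer $\mathsf f(\vec t)\doteq\mathsf f(\vec u)$; (sym); (trans) from $t_1\doteq t_2,\dots,t_k\doteq t_{k+1}$ infer $t_1\doteq t_{k+1}$; (proj$_i$) from $\mathsf f(t_1..t_r)\doteq\mathsf f(u_1..u_r)$ infer $t_i\doteq u_i$ provided the positions of all $t_j,u_j$ are abstractable in that assertion w.r.t. $S$; ($\wedge$I); ($\wedge$E$_i$); (subst) from $t\twoheadleftarrow l$, $t\doteq u$ infer $u\twoheadleftarrow l$; ($\exists$I) from $\alpha[P\mapsto t]$ and $S\vdash_{dy}t$ infer $\exists x.\alpha$ where $P=\mathrm{pos}_x(\alpha)\subseteq\mathbb A(S\cup\{x\},\alpha)$; ($\exists$E) from $S;A\vdash\exists x.\alpha$ and $S\cup\{y\};A\cup\{\alpha[P\mapsto y]\}\vdash\gamma$ infer $S;A\vdash\gamma$ where $y$ is fresh and $P=\mathrm{pos}_x(\alpha)$; (say) from $\alpha$ and $S\vdash_{dy}k$ infer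 $\mathit{pk}(k)\ \mathit{says}\ \alpha$; (prom) from $t\twoheadleftarrow[n]$ infer $t\doteq n$; (int) from $t\twoheadleftarrow l_1,\dots,t\twoheadleftarrow l_m$ infer $t\twoheadleftarrow\bigcap l_j$; (wk) from $t\doteq n_i$ and $S\vdash_{dy}n_j$ for all $j$ infer $t\twoheadleftarrow[n_1..n_k]$. $\vdash_{eq}$: derivability without $\wedge$I, $\wedge$E, $\exists$I, $\exists$E, say. Kernel: $\mathit{ker}(S;A)=(S\cup\mathrm{bv}(A);\ \bigcup_{\alpha\in A}\mathsf{at}(\alpha))$, $\mathsf{at}(\alpha)$ the maximal atomic subformulas. Hereditary atoms $\mathsf{hat}$: $\mathsf{hat}(\alpha\wedge\beta)=\mathsf{hat}(\alpha)\cup\mathsf{hat}(\beta)$, $\mathsf{hat}(\exists x.\alpha)=\mathsf{hat}(\alpha)$, $\mathsf{hat}(\mathit{pk}(k)\ \mathit{says}\ \alpha)=\{\mathit{pk}(k)\ \mathit{says}\ \alpha\}\cup\mathsf{hat}(\alpha)$, otherwise $\{\gamma\}$. Protocols and runs. Agents $\mathscr A\subseteq\mathscr N$ include the intruder $I$. A protocol is a finite set of roles $(\beta_1,\alpha_1)\cdots(\beta_m,\alpha_m)$ (receive $\beta_j$, send $\alpha_j$). A free variable is an agent variable if it first occurs in some $\alpha_j$, otherwise an intruder variable. A session is $u:(\beta_1\Rightarrow\alpha_1)\cdots u:(\beta_\ell\Rightarrow\alpha_\ell)$, $u\in\mathscr A$, a prefix of a role with agent variables instantiated by names; coherent sets of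 sessions share no free variables between distinct sessions. $\mathit{update}((X;\Phi),\alpha)=(X\cup\mathsf{pubs}(\alpha);\Phi\cup\{\alpha\})$. Run setting: fix a run $(\xi,\sigma)$: $\xi=u_1:(\beta_1\Rightarrow\alpha_1),\dots,u_n:(\beta_n\Rightarrow\alpha_n)$ an interleaving of a finite coherent set of sessions, $\sigma$ a ground substitution with domain the free variables of $\xi$, with knowledge functions $\mathsf k_0,\dots,\mathsf k_n$: $\mathsf k_0(a)=(X_a;\emptyset)$, and for $1\le i\le n$, $\mathsf k_i(a)=\mathsf k_{i-1}(a)$ for $a\notin\{u_i,I\}$, $\mathsf k_i(u_i)=\mathit{update}(\mathsf k_{i-1}(u_i),\beta_i)$, $\mathsf k_i(I)=\mathit{update}(\mathsf k_{i-1}(I),\alpha_i)$, with $\mathsf k_i(u_i)\vdash_a\alpha_i$ and $\sigma(\mathsf k_{i-1}(I))\vdash_a\sigma(\beta_i)$. Bound variables are renamed so that the free variables of $\xi$ are not in $\mathscr V_q$, no variable occurs both free and bound, and no variable is bound by two quantifiers. Let $(T_i;E_i)=\mathit{ker}(\mathsf k_i(I))$ for $0\le i\le n$ and $(U_i;F_i)=\mathit{ker}(\mathsf k_i(u_i))$ for $1\le i\le n$. For each $1\le i\le n$ fix $X_i\subseteq\mathsf{hat}(\beta_i)$ and a substitution $\mu_i$ with domain $\mathrm{bv}(\beta_i)\setminus\mathrm{bv}(X_i)$ such that $\sigma(T_{i-1})\vdash_{dy}\mu_i(x)$ for all $x\in\mathrm{dom}(\mu_i)$ and $\sigma(T_{i-1};E_{i-1})\vdash_{eq}\sigma\mu_i(\gamma)$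 for all $\gamma\in X_i$; and $Y_i\subseteq\mathsf{hat}(\alpha_i)$ and $\theta_i$ with domain $\mathrm{bv}(\alpha_i)\setminus\mathrm{bv}(Y_i)$ such that $\sigma(U_i)\vdash_{dy}\theta_i(x)$ for $x\in\mathrm{dom}(\theta_i)$ and $\sigma(U_i;F_i)\vdash_{eq}\sigma\theta_i(\gamma)$ for $\gamma\in Y_i$. Let $\omega=\sigma\mu_1\theta_1\cdots\mu_n\theta_n$. Let $\mathscr C=\bigcup_{i\le n}\big(\mathsf{st}(T_i\cup U_i)\cup\mathsf{st}(E_i\cup F_i)\big)$ and $\mathscr D=\mathscr C\setminus\mathscr V$. Typed proofs: a $\vdash_{dy}$ proof is typed if each of its subproofs either ends in a constructor rule or has conclusion in $\sigma(\mathscr D)\cup\mathscr V_q$.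
   Formalization: The initial knowledge X_a of every agent is assumed to consist of ground terms; if the intruder initially knew a term variable x with σ(x)=f(m), the claim could fail. *)

theory Defs
  imports Main
begin

text \<open>Names and variables are two types, so they are disjoint; the quantified variables are a
  parameter \<open>qvars\<close> of the theory of terms below.\<close>

datatype ('f, 'n, 'v) trm = Var 'v | Nm 'n | Fun 'f "('f, 'n, 'v) trm list"

fun vars :: "('f, 'n, 'v) trm \<Rightarrow> 'v set" where
  "vars (Var x) = {x}"
| "vars (Nm m) = {}"
| "vars (Fun f ts) = (\<Union>t\<in>set ts. vars t)"

fun st :: "('f, 'n, 'v) trm \<Rightarrow> ('f, 'n, 'v) trm set" where
  "st (Var x) = {Var x}"
| "st (Nm m) = {Nm m}"
| "st (Fun f ts) = {Fun f ts} \<union> (\<Union>t\<in>set ts. st t)"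

fun inst :: "('v \<Rightarrow> ('f, 'n, 'w) trm) \<Rightarrow> ('f, 'n, 'v) trm \<Rightarrow> ('f, 'n, 'w) trm" where
  "inst \<tau> (Var x) = \<tau> x"
| "inst \<tau> (Nm m) = Nm m"
| "inst \<tau> (Fun f ts) = Fun f (map (inst \<tau>) ts)"

type_synonym ('f, 'n, 'v) sbst = "'v \<rightharpoonup> ('f, 'n, 'v) trm"

definition tsubst :: "('f, 'n, 'v) sbst \<Rightarrow> ('f, 'n, 'v) trm \<Rightarrow> ('f, 'n, 'v) trm" where
  "tsubst s = inst (\<lambda>x. case s x of None \<Rightarrow> Var x | Some t \<Rightarrow> t)"


section \<open>Term derivability\<close>

text \<open>A destructor rule is a schema \<open>(f, ts, us, j)\<close> over schematic variables of type \<^typ>\<open>nat\<close>: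
  from the major premise \<open>f(ts)\<close> and the further premises \<open>us\<close> infer the \<open>j\<close>-th element of \<open>ts\<close>.
  The term arguments may be compound, as in: from \<open>aenc(x, pk(k))\<close> and \<open>k\<close> infer \<open>x\<close>.\<close>

type_synonym ('f, 'n) drule =
  "'f \<times> ('f, 'n, nat) trm list \<times> ('f, 'n, nat) trm list \<times> nat"

record ('f, 'n, 'v) dy_theory =
  arity  :: "'f \<Rightarrow> nat"
  pkop   :: 'f
  drules :: "('f, 'n) drule set"
  qvars  :: "'v set"

fun wf_trm :: "('f, 'n, 'v) dy_theory \<Rightarrow> ('f, 'n, 'w) trm \<Rightarrow> bool" where
  "wf_trm G (Var x) = True"
| "wf_trm G (Nm m) = True"
| "wf_trm G (Fun f ts) = (length ts = arity G f \<and> (\<forall>t\<in>set ts. wf_trm G t))"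

text \<open>\<open>Des t p ps\<close> is a destructor step with conclusion \<open>t\<close>, major premise \<open>p\<close>, and other
  premises \<open>ps\<close>.\<close>

datatype ('f, 'n, 'v) dyproof =
    Axm "('f, 'n, 'v) trm"
  | is_Con: Con 'f "('f, 'n, 'v) dyproof list"
  | Des "('f, 'n, 'v) trm" "('f, 'n, 'v) dyproof" "('f, 'n, 'v) dyproof list"

fun concl :: "('f, 'n, 'v) dyproof \<Rightarrow> ('f, 'n, 'v) trm" where
  "concl (Axm t) = t"
| "concl (Con f ps) = Fun f (map concl ps)"
| "concl (Des t p ps) = t"

fun valid :: "('f, 'n, 'v) dy_theory \<Rightarrow> ('f, 'n, 'v) trm set \<Rightarrow> ('f, 'n, 'v) dyproof \<Rightarrow> bool" where
  "valid G X (Axm t) = (t \<in> X)"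
| "valid G X (Con f ps) = (length ps = arity G f \<and> (\<forall>q\<in>set ps. valid G X q))"
| "valid G X (Des t p ps) =
    ((\<exists>f ts us j \<tau>. (f, ts, us, j) \<in> drules G \<and> concl p = Fun f (map (inst \<tau>) ts) \<and>
        map concl ps = map (inst \<tau>) us \<and> t = inst \<tau> (ts ! j)) \<and>
     valid G X p \<and> (\<forall>q\<in>set ps. valid G X q))"

fun subproofs :: "('f, 'n, 'v) dyproof \<Rightarrow> ('f, 'n, 'v) dyproof set" where
  "subproofs (Axm t) = {Axm t}"
| "subproofs (Con f ps) = {Con f ps} \<union> (\<Union>q\<in>set ps. subproofs q)"
| "subproofs (Des t p ps) = {Des t p ps} \<union> subproofs p \<union> (\<Union>q\<in>set ps. subproofs q)"

definition normal :: "('f, 'n, 'v) dyproof \<Rightarrow> bool" where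
  "normal \<pi> \<longleftrightarrow> (\<forall>t p ps. Des t p ps \<in> subproofs \<pi> \<longrightarrow> \<not> is_Con p)"

definition proves ::
  "('f, 'n, 'v) dy_theory \<Rightarrow> ('f, 'n, 'v) trm set \<Rightarrow> ('f, 'n, 'v) dyproof \<Rightarrow> ('f, 'n, 'v) trm \<Rightarrow> bool"
where
  "proves G X \<pi> t \<longleftrightarrow> valid G X \<pi> \<and> concl \<pi> = t"

definition dy :: "('f, 'n, 'v) dy_theory \<Rightarrow> ('f, 'n, 'v) trm set \<Rightarrow> ('f, 'n, 'v) trm \<Rightarrow> bool" where
  "dy G X t \<longleftrightarrow> (\<exists>\<pi>. proves G X \<pi> t)"

text \<open>The standing assumptions: arities, normalization, and the subterm property of normal proofs.
  An axiom counts as a destructor.\<close>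

definition wf_dy_theory :: "('f, 'n, 'v) dy_theory \<Rightarrow> bool" where
  "wf_dy_theory G \<longleftrightarrow>
    arity G (pkop G) = 1 \<and>
    (\<forall>(f, ts, us, j) \<in> drules G. length ts = arity G f \<and> j < length ts) \<and>
    (\<forall>X t. (\<forall>s\<in>X. wf_trm G s) \<and> dy G X t \<longrightarrow> (\<exists>\<pi>. proves G X \<pi> t \<and> normal \<pi>)) \<and>
    (\<forall>X t \<pi>. (\<forall>s\<in>X. wf_trm G s) \<and> proves G X \<pi> t \<and> normal \<pi> \<longrightarrow>
      concl ` subproofs \<pi> \<subseteq> (\<Union>s\<in>X \<union> {t}. st s) \<and>
      (\<not> is_Con \<pi> \<longrightarrow> concl ` subproofs \<pi> \<subseteq> (\<Union>s\<in>X. st s)))"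


section \<open>Positions in terms\<close>

type_synonym pos = "nat list"

lemma size_nth_less [termination_simp]: "i < length ts \<Longrightarrow> size (ts ! i) < Suc (size_list size ts)"
  by (meson le_imp_less_Suc nth_mem order_refl size_list_estimation')

fun poss :: "('f, 'n, 'v) trm \<Rightarrow> pos set" where
  "poss (Var x) = {[]}"
| "poss (Nm m) = {[]}"
| "poss (Fun f ts) = {[]} \<union> (\<Union>i<length ts. (#) i ` poss (ts ! i))"

fun subt_at :: "('f, 'n, 'v) trm \<Rightarrow> pos \<Rightarrow> ('f, 'n, 'v) trm" where
  "subt_at t [] = t"
| "subt_at (Fun f ts) (i # p) = subt_at (ts ! i) p"
| "subt_at t (i # p) = undefined"

definition vposs :: "'v \<Rightarrow> ('f, 'n, 'v) trm \<Rightarrow> pos set" where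
  "vposs x t = {p \<in> poss t. subt_at t p = Var x}"

definition below :: "nat \<Rightarrow> pos set \<Rightarrow> pos set" where
  "below i P = {p. i # p \<in> P}"

fun repl :: "('f, 'n, 'v) trm \<Rightarrow> pos set \<Rightarrow> ('f, 'n, 'v) trm \<Rightarrow> ('f, 'n, 'v) trm" where
  "repl (Var x) P r = (if [] \<in> P then r else Var x)"
| "repl (Nm m) P r = (if [] \<in> P then r else Nm m)"
| "repl (Fun f ts) P r =
    (if [] \<in> P then r else Fun f (map (\<lambda>i. repl (ts ! i) (below i P) r) [0..<length ts]))"

definition abstr_trm ::
  "('f, 'n, 'v) dy_theory \<Rightarrow> ('f, 'n, 'v) trm set \<Rightarrow> ('f, 'n, 'v) trm \<Rightarrow> pos set" where
  "abstr_trm G S t =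
    {p \<in> poss t. \<forall>q \<in> {[]} \<union> {q @ [i] | q i. q @ [i] \<in> poss t \<and> (\<exists>r. r \<noteq> [] \<and> p = q @ r)}.
       dy G S (subt_at t q)}"


section \<open>Assertions\<close>

text \<open>\<open>Mem t ns\<close> is \<open>t \<Leftarrow> [ns]\<close> (one of the names \<open>ns\<close>) and \<open>Says k \<alpha>\<close> is
  \<open>pk(k) says \<alpha>\<close>.  The restriction of the arguments of predicates and of \<open>Mem\<close> to names and
  variables is imposed on protocols by \<open>wf_asrt\<close> below; it is not part of the type, because
  it is not preserved by substitutions.\<close>

datatype ('f, 'n, 'v, 'p) asrt =
    Eq "('f, 'n, 'v) trm" "('f, 'n, 'v) trm"
  | Pred 'p "('f, 'n, 'v) trm list"
  | Mem "('f, 'n, 'v) trm" "'n list"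
  | Conj "('f, 'n, 'v, 'p) asrt" "('f, 'n, 'v, 'p) asrt"
  | Ex 'v "('f, 'n, 'v, 'p) asrt"
  | Says "('f, 'n, 'v) trm" "('f, 'n, 'v, 'p) asrt"

definition is_atom :: "('f, 'n, 'v) trm \<Rightarrow> bool" where
  "is_atom t \<longleftrightarrow> (\<exists>x. t = Var x) \<or> (\<exists>m. t = Nm m)"

fun wf_asrt :: "('f, 'n, 'v) dy_theory \<Rightarrow> ('f, 'n, 'v, 'p) asrt \<Rightarrow> bool" where
  "wf_asrt G (Eq t u) = (wf_trm G t \<and> wf_trm G u)"
| "wf_asrt G (Pred P us) = (\<forall>u\<in>set us. is_atom u)"
| "wf_asrt G (Mem t ns) = is_atom t"
| "wf_asrt G (Conj a b) = (wf_asrt G a \<and> wf_asrt G b)"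
| "wf_asrt G (Ex x a) = (x \<in> qvars G \<and> wf_asrt G a)"
| "wf_asrt G (Says k a) = (wf_trm G k \<and> wf_asrt G a)"

fun fv :: "('f, 'n, 'v, 'p) asrt \<Rightarrow> 'v set" where
  "fv (Eq t u) = vars t \<union> vars u"
| "fv (Pred P us) = (\<Union>u\<in>set us. vars u)"
| "fv (Mem t ns) = vars t"
| "fv (Conj a b) = fv a \<union> fv b"
| "fv (Ex x a) = fv a - {x}"
| "fv (Says k a) = vars k \<union> fv a"

text \<open>One entry per quantifier occurrence.\<close>

fun binders :: "('f, 'n, 'v, 'p) asrt \<Rightarrow> 'v list" where
  "binders (Eq t u) = []"
| "binders (Pred P us) = []"
| "binders (Mem t ns) = []"
| "binders (Conj a b) = binders a @ binders b"
| "binders (Ex x a) = x # binders a"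
| "binders (Says k a) = binders a"

definition bv :: "('f, 'n, 'v, 'p) asrt \<Rightarrow> 'v set" where
  "bv a = set (binders a)"

fun asubst :: "('f, 'n, 'v) sbst \<Rightarrow> ('f, 'n, 'v, 'p) asrt \<Rightarrow> ('f, 'n, 'v, 'p) asrt" where
  "asubst s (Eq t u) = Eq (tsubst s t) (tsubst s u)"
| "asubst s (Pred P us) = Pred P (map (tsubst s) us)"
| "asubst s (Mem t ns) = Mem (tsubst s t) ns"
| "asubst s (Conj a b) = Conj (asubst s a) (asubst s b)"
| "asubst s (Ex x a) = Ex x (asubst (s(x := None)) a)"
| "asubst s (Says k a) = Says (tsubst s k) (asubst s a)"

fun ast :: "('f, 'n, 'v) dy_theory \<Rightarrow> ('f, 'n, 'v, 'p) asrt \<Rightarrow> ('f, 'n, 'v) trm set" where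
  "ast G (Eq t u) = st t \<union> st u"
| "ast G (Pred P us) = (\<Union>u\<in>set us. st u)"
| "ast G (Mem t ns) = st t \<union> Nm ` set ns"
| "ast G (Conj a b) = ast G a \<union> ast G b"
| "ast G (Ex x a) = {Var x} \<union> ast G a"
| "ast G (Says k a) = st (Fun (pkop G) [k]) \<union> ast G a"

text \<open>Maximality in \<open>pubs\<close> is that of occurrences: a subterm is collected at each occurrence
  that lies in no larger subterm free of quantified variables.\<close>

fun tpubs :: "('f, 'n, 'v) dy_theory \<Rightarrow> ('f, 'n, 'v) trm \<Rightarrow> ('f, 'n, 'v) trm set" where
  "tpubs G (Var x) = (if x \<in> qvars G then {} else {Var x})"
| "tpubs G (Nm m) = {Nm m}"
| "tpubs G (Fun f ts) =
    (if vars (Fun f ts) \<inter> qvars G = {} then {Fun f ts} else (\<Union>t\<in>set ts. tpubs G t))"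

fun pubs :: "('f, 'n, 'v) dy_theory \<Rightarrow> ('f, 'n, 'v, 'p) asrt \<Rightarrow> ('f, 'n, 'v) trm set" where
  "pubs G (Eq t u) = tpubs G t \<union> tpubs G u"
| "pubs G (Pred P us) = (\<Union>u\<in>set us. tpubs G u)"
| "pubs G (Mem t ns) = tpubs G t \<union> Nm ` set ns"
| "pubs G (Conj a b) = pubs G a \<union> pubs G b"
| "pubs G (Ex x a) = pubs G a"
| "pubs G (Says k a) = tpubs G (Fun (pkop G) [k]) \<union> pubs G a"

text \<open>Positions of the free occurrences of a variable.  The positions of an assertion are
  numbered from 0 at every node; those of \<open>Says k a\<close> are 0 for \<open>pk(k)\<close>, 00 for \<open>k\<close>, and 1
  for \<open>a\<close>.  Compound arguments of \<open>Pred\<close>, \<open>Mem\<close> and \<open>Says\<close> have positions inside them, none of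
  which is abstractable.\<close>

fun fposs :: "('f, 'n, 'v) dy_theory \<Rightarrow> 'v \<Rightarrow> ('f, 'n, 'v, 'p) asrt \<Rightarrow> pos set" where
  "fposs G x (Eq t u) = (#) 0 ` vposs x t \<union> (#) 1 ` vposs x u"
| "fposs G x (Pred P us) = (\<Union>i<length us. (#) i ` vposs x (us ! i))"
| "fposs G x (Mem t ns) = (#) 0 ` vposs x t"
| "fposs G x (Conj a b) = (#) 0 ` fposs G x a \<union> (#) 1 ` fposs G x b"
| "fposs G x (Ex y a) = (if x = y then {} else (#) 0 ` fposs G x a)"
| "fposs G x (Says k a) = (#) 0 ` vposs x (Fun (pkop G) [k]) \<union> (#) 1 ` fposs G x a"

text \<open>The replacement \<open>\<alpha>[P \<mapsto> r]\<close>, used only for sets \<open>P\<close> of positions of variables.\<close>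

fun arepl ::
  "('f, 'n, 'v, 'p) asrt \<Rightarrow> pos set \<Rightarrow> ('f, 'n, 'v) trm \<Rightarrow> ('f, 'n, 'v, 'p) asrt" where
  "arepl (Eq t u) P r = Eq (repl t (below 0 P) r) (repl u (below 1 P) r)"
| "arepl (Pred Q us) P r = Pred Q (map (\<lambda>i. repl (us ! i) (below i P) r) [0..<length us])"
| "arepl (Mem t ns) P r = Mem (repl t (below 0 P) r) ns"
| "arepl (Conj a b) P r = Conj (arepl a (below 0 P) r) (arepl b (below 1 P) r)"
| "arepl (Ex x a) P r = Ex x (arepl a (below 0 P) r)"
| "arepl (Says k a) P r = Says (repl k (below 0 (below 0 P)) r) (arepl a (below 1 P) r)"

fun abstr ::
  "('f, 'n, 'v) dy_theory \<Rightarrow> ('f, 'n, 'v) trm set \<Rightarrow> ('f, 'n, 'v, 'p) asrt \<Rightarrow> pos set" where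
  "abstr G S (Eq t u) = (#) 0 ` abstr_trm G S t \<union> (#) 1 ` abstr_trm G S u"
| "abstr G S (Pred P us) = {[i] | i. i < length us \<and> dy G S (us ! i)}"
| "abstr G S (Mem t ns) = {[0]}"
| "abstr G S (Conj a b) = (#) 0 ` abstr G S a \<union> (#) 1 ` abstr G S b"
| "abstr G S (Ex x a) = (#) 0 ` abstr G (S \<union> {Var x}) a"
| "abstr G S (Says k a) = {[0]} \<union> (#) 1 ` abstr G S a"

text \<open>Renaming of bound variables, within the quantified variables.\<close>

inductive alpha ::
  "('f, 'n, 'v) dy_theory \<Rightarrow> ('f, 'n, 'v, 'p) asrt \<Rightarrow> ('f, 'n, 'v, 'p) asrt \<Rightarrow> bool"
  for G :: "('f, 'n, 'v) dy_theory"
where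
  alpha_refl: "alpha G a a"
| alpha_sym: "alpha G a b \<Longrightarrow> alpha G b a"
| alpha_trans: "alpha G a b \<Longrightarrow> alpha G b c \<Longrightarrow> alpha G a c"
| alpha_conj: "alpha G a a' \<Longrightarrow> alpha G b b' \<Longrightarrow> alpha G (Conj a b) (Conj a' b')"
| alpha_ex: "alpha G a a' \<Longrightarrow> alpha G (Ex x a) (Ex x a')"
| alpha_says: "alpha G a a' \<Longrightarrow> alpha G (Says k a) (Says k a')"
| alpha_rename: "x \<in> qvars G \<Longrightarrow> y \<in> qvars G \<Longrightarrow> y \<notin> fv a \<union> bv a \<Longrightarrow>
    alpha G (Ex x a) (Ex y (arepl a (fposs G x a) (Var y)))"


section \<open>Assertion derivability\<close>

text \<open>\<open>aderiv G True\<close> is the full system; \<open>aderiv G False\<close> is the one without the rules for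
  conjunction, the quantifier, and the introduction of \<open>says\<close>.  Assertions are identified up to
  renaming of bound variables, which is the rule \<open>ren\<close>.\<close>

inductive aderiv ::
  "('f, 'n, 'v) dy_theory \<Rightarrow> bool \<Rightarrow> ('f, 'n, 'v) trm set \<Rightarrow> ('f, 'n, 'v, 'p) asrt set \<Rightarrow>
   ('f, 'n, 'v, 'p) asrt \<Rightarrow> bool"
  for G :: "('f, 'n, 'v) dy_theory" and full :: bool
where
  ax: "a \<in> A \<Longrightarrow> aderiv G full S A a"
| ren: "aderiv G full S A a \<Longrightarrow> alpha G a b \<Longrightarrow> aderiv G full S A b"
| eq: "dy G S t \<Longrightarrow> aderiv G full S A (Eq t t)"
| cons: "length ts = arity G f \<Longrightarrow> length us = arity G f \<Longrightarrow>
    (\<forall>j<length ts. aderiv G full S A (Eq (ts ! j) (us ! j))) \<Longrightarrow>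
    aderiv G full S A (Eq (Fun f ts) (Fun f us))"
| sym: "aderiv G full S A (Eq t u) \<Longrightarrow> aderiv G full S A (Eq u t)"
| trans: "k \<ge> 1 \<Longrightarrow> length ts = k + 1 \<Longrightarrow>
    (\<forall>j<k. aderiv G full S A (Eq (ts ! j) (ts ! Suc j))) \<Longrightarrow>
    aderiv G full S A (Eq (ts ! 0) (ts ! k))"
| proj: "aderiv G full S A (Eq (Fun f ts) (Fun f us)) \<Longrightarrow> length ts = length us \<Longrightarrow>
    (\<forall>j<length ts. {[0, j], [1, j]} \<subseteq> abstr G S (Eq (Fun f ts) (Fun f us) :: ('f, 'n, 'v, 'p) asrt)) \<Longrightarrow>
    i < length ts \<Longrightarrow> aderiv G full S A (Eq (ts ! i) (us ! i))"
| subst: "aderiv G full S A (Mem t l) \<Longrightarrow> aderiv G full S A (Eq t u) \<Longrightarrow>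
    aderiv G full S A (Mem u l)"
| prom: "aderiv G full S A (Mem t [m]) \<Longrightarrow> aderiv G full S A (Eq t (Nm m))"
| int: "ls \<noteq> [] \<Longrightarrow> (\<forall>l\<in>set ls. aderiv G full S A (Mem t l)) \<Longrightarrow>
    set l' = (\<Inter>l\<in>set ls. set l) \<Longrightarrow> aderiv G full S A (Mem t l')"
| wk: "i < length l \<Longrightarrow> aderiv G full S A (Eq t (Nm (l ! i))) \<Longrightarrow>
    (\<forall>m\<in>set l. dy G S (Nm m)) \<Longrightarrow> aderiv G full S A (Mem t l)"
| conjI: "full \<Longrightarrow> aderiv G full S A a \<Longrightarrow> aderiv G full S A b \<Longrightarrow>
    aderiv G full S A (Conj a b)"
| conjE0: "full \<Longrightarrow> aderiv G full S A (Conj a b) \<Longrightarrow> aderiv G full S A a"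
| conjE1: "full \<Longrightarrow> aderiv G full S A (Conj a b) \<Longrightarrow> aderiv G full S A b"
| exI: "full \<Longrightarrow> x \<in> qvars G \<Longrightarrow> P = fposs G x a \<Longrightarrow> vars t \<inter> bv a = {} \<Longrightarrow>
    aderiv G full S A (arepl a P t) \<Longrightarrow> dy G S t \<Longrightarrow> P \<subseteq> abstr G (S \<union> {Var x}) a \<Longrightarrow>
    aderiv G full S A (Ex x a)"
| exE: "full \<Longrightarrow> aderiv G full S A (Ex x a) \<Longrightarrow> P = fposs G x a \<Longrightarrow> y \<in> qvars G \<Longrightarrow>
    y \<notin> (\<Union>s\<in>S. vars s) \<union> (\<Union>b\<in>A \<union> {Ex x a, c}. fv b \<union> bv b) \<Longrightarrow>
    aderiv G full (S \<union> {Var y}) (A \<union> {arepl a P (Var y)}) c \<Longrightarrow>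
    aderiv G full S A c"
| say: "full \<Longrightarrow> aderiv G full S A a \<Longrightarrow> dy G S k \<Longrightarrow> aderiv G full S A (Says k a)"

abbreviation deriv_a ::
  "('f, 'n, 'v) dy_theory \<Rightarrow> ('f, 'n, 'v) trm set \<times> ('f, 'n, 'v, 'p) asrt set \<Rightarrow>
   ('f, 'n, 'v, 'p) asrt \<Rightarrow> bool" where
  "deriv_a G K \<equiv> aderiv G True (fst K) (snd K)"

abbreviation deriv_eq ::
  "('f, 'n, 'v) dy_theory \<Rightarrow> ('f, 'n, 'v) trm set \<times> ('f, 'n, 'v, 'p) asrt set \<Rightarrow>
   ('f, 'n, 'v, 'p) asrt \<Rightarrow> bool" where
  "deriv_eq G K \<equiv> aderiv G False (fst K) (snd K)"

definition ksubst ::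
  "('f, 'n, 'v) sbst \<Rightarrow> ('f, 'n, 'v) trm set \<times> ('f, 'n, 'v, 'p) asrt set \<Rightarrow>
   ('f, 'n, 'v) trm set \<times> ('f, 'n, 'v, 'p) asrt set" where
  "ksubst s K = (tsubst s ` fst K, asubst s ` snd K)"

fun atoms :: "('f, 'n, 'v, 'p) asrt \<Rightarrow> ('f, 'n, 'v, 'p) asrt set" where
  "atoms (Conj a b) = atoms a \<union> atoms b"
| "atoms (Ex x a) = atoms a"
| "atoms a = {a}"

definition ker ::
  "('f, 'n, 'v) trm set \<times> ('f, 'n, 'v, 'p) asrt set \<Rightarrow>
   ('f, 'n, 'v) trm set \<times> ('f, 'n, 'v, 'p) asrt set" where
  "ker K = (fst K \<union> Var ` (\<Union>a\<in>snd K. bv a), \<Union>a\<in>snd K. atoms a)"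

fun hat :: "('f, 'n, 'v, 'p) asrt \<Rightarrow> ('f, 'n, 'v, 'p) asrt set" where
  "hat (Conj a b) = hat a \<union> hat b"
| "hat (Ex x a) = hat a"
| "hat (Says k a) = {Says k a} \<union> hat a"
| "hat a = {a}"


section \<open>Protocols and runs\<close>

text \<open>A pair consists of an assertion received and an assertion sent in reply.\<close>

type_synonym ('f, 'n, 'v, 'p) role = "(('f, 'n, 'v, 'p) asrt \<times> ('f, 'n, 'v, 'p) asrt) list"
type_synonym ('f, 'n, 'v, 'p) event = "'n \<times> ('f, 'n, 'v, 'p) asrt \<times> ('f, 'n, 'v, 'p) asrt"

definition protocol :: "('f, 'n, 'v) dy_theory \<Rightarrow> ('f, 'n, 'v, 'p) role set \<Rightarrow> bool" where
  "protocol G Pr \<longleftrightarrow> finite Pr \<and> (\<forall>r\<in>Pr. \<forall>(b, a)\<in>set r. wf_asrt G b \<and> wf_asrt G a)"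

definition role_fv :: "('f, 'n, 'v, 'p) role \<Rightarrow> 'v set" where
  "role_fv r = (\<Union>(b, a)\<in>set r. fv b \<union> fv a)"

definition agent_vars :: "('f, 'n, 'v, 'p) role \<Rightarrow> 'v set" where
  "agent_vars r = {x. \<exists>j<length r. x \<in> fv (snd (r ! j)) \<and> x \<notin> fv (fst (r ! j)) \<and>
      (\<forall>k<j. x \<notin> fv (fst (r ! k)) \<union> fv (snd (r ! k)))}"

definition intruder_vars :: "('f, 'n, 'v, 'p) role \<Rightarrow> 'v set" where
  "intruder_vars r = role_fv r - agent_vars r"

text \<open>Besides instantiating the agent variables, a session may rename the intruder variables
  injectively, and the bound variables: without this, two sessions of one role could not
  be coherent.\<close>

definition session ::
  "('f, 'n, 'v) dy_theory \<Rightarrow> 'n set \<Rightarrow> ('f, 'n, 'v, 'p) role set \<Rightarrow> ('f, 'n, 'v, 'p) event list \<Rightarrow> bool"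
where
  "session G Ag Pr s \<longleftrightarrow>
    (\<exists>u\<in>Ag. \<exists>r\<in>Pr. \<exists>\<rho> :: ('f, 'n, 'v) sbst.
       length s \<le> length r \<and>
       (\<forall>x\<in>agent_vars r. \<exists>m. \<rho> x = Some (Nm m)) \<and>
       (\<forall>x\<in>intruder_vars r. \<exists>y. \<rho> x = Some (Var y) \<and> y \<notin> qvars G) \<and>
       inj_on \<rho> (intruder_vars r) \<and>
       (\<forall>j<length s. \<exists>b a. s ! j = (u, b, a) \<and>
          alpha G (asubst \<rho> (fst (r ! j))) b \<and> alpha G (asubst \<rho> (snd (r ! j))) a))"

definition events_fv :: "('f, 'n, 'v, 'p) event list \<Rightarrow> 'v set" where
  "events_fv s = (\<Union>(u, b, a)\<in>set s. fv b \<union> fv a)"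

definition events_binders :: "('f, 'n, 'v, 'p) event list \<Rightarrow> 'v list" where
  "events_binders s = concat (map (\<lambda>(u, b, a). binders b @ binders a) s)"

definition coherent :: "('f, 'n, 'v, 'p) event list set \<Rightarrow> bool" where
  "coherent Ss \<longleftrightarrow> (\<forall>s\<in>Ss. \<forall>s'\<in>Ss. s \<noteq> s' \<longrightarrow> events_fv s \<inter> events_fv s' = {})"

text \<open>\<open>c i\<close> is the session that the \<open>i\<close>-th event belongs to.\<close>

definition interleaving ::
  "('f, 'n, 'v, 'p) event list set \<Rightarrow> ('f, 'n, 'v, 'p) event list \<Rightarrow> bool" where
  "interleaving Ss \<xi> \<longleftrightarrow>
    (\<exists>c. (\<forall>i<length \<xi>. c i \<in> Ss) \<and> (\<forall>s\<in>Ss. nths \<xi> {i. c i = s} = s))"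

definition update ::
  "('f, 'n, 'v) dy_theory \<Rightarrow> ('f, 'n, 'v) trm set \<times> ('f, 'n, 'v, 'p) asrt set \<Rightarrow>
   ('f, 'n, 'v, 'p) asrt \<Rightarrow> ('f, 'n, 'v) trm set \<times> ('f, 'n, 'v, 'p) asrt set" where
  "update G K a = (fst K \<union> pubs G a, snd K \<union> {a})"

text \<open>Events are numbered from 1.\<close>

definition actor :: "('f, 'n, 'v, 'p) event list \<Rightarrow> nat \<Rightarrow> 'n" where
  "actor \<xi> i = fst (\<xi> ! (i - 1))"

definition recv :: "('f, 'n, 'v, 'p) event list \<Rightarrow> nat \<Rightarrow> ('f, 'n, 'v, 'p) asrt" where
  "recv \<xi> i = fst (snd (\<xi> ! (i - 1)))"

definition sent :: "('f, 'n, 'v, 'p) event list \<Rightarrow> nat \<Rightarrow> ('f, 'n, 'v, 'p) asrt" where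
  "sent \<xi> i = snd (snd (\<xi> ! (i - 1)))"

type_synonym ('f, 'n, 'v, 'p) knowledge =
  "nat \<Rightarrow> 'n \<Rightarrow> ('f, 'n, 'v) trm set \<times> ('f, 'n, 'v, 'p) asrt set"

definition run ::
  "('f, 'n, 'v) dy_theory \<Rightarrow> 'n set \<Rightarrow> 'n \<Rightarrow> ('f, 'n, 'v, 'p) role set \<Rightarrow>
   ('n \<Rightarrow> ('f, 'n, 'v) trm set) \<Rightarrow> ('f, 'n, 'v, 'p) event list \<Rightarrow> ('f, 'n, 'v) sbst \<Rightarrow>
   ('f, 'n, 'v, 'p) knowledge \<Rightarrow> bool"
where
  "run G Ag I Pr X \<xi> \<sigma> k \<longleftrightarrow>
    (\<exists>Ss. finite Ss \<and> (\<forall>s\<in>Ss. session G Ag Pr s) \<and> coherent Ss \<and> interleaving Ss \<xi>) \<and>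
    dom \<sigma> = events_fv \<xi> \<and> (\<forall>t\<in>ran \<sigma>. vars t = {} \<and> wf_trm G t) \<and>
    (\<forall>a\<in>Ag. \<forall>t\<in>X a. vars t = {} \<and> wf_trm G t) \<and>
    (\<forall>a\<in>Ag. k 0 a = (X a, {})) \<and>
    (\<forall>i\<in>{1..length \<xi>}.
       (\<forall>a\<in>Ag - {actor \<xi> i, I}. k i a = k (i - 1) a) \<and>
       k i (actor \<xi> i) = update G (k (i - 1) (actor \<xi> i)) (recv \<xi> i) \<and>
       k i I = update G (k (i - 1) I) (sent \<xi> i) \<and>
       deriv_a G (k i (actor \<xi> i)) (sent \<xi> i) \<and>
       deriv_a G (ksubst \<sigma> (k (i - 1) I)) (asubst \<sigma> (recv \<xi> i)))"

definition bound_renamed :: "('f, 'n, 'v) dy_theory \<Rightarrow> ('f, 'n, 'v, 'p) event list \<Rightarrow> bool" where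
  "bound_renamed G \<xi> \<longleftrightarrow>
    events_fv \<xi> \<inter> qvars G = {} \<and>
    events_fv \<xi> \<inter> set (events_binders \<xi>) = {} \<and>
    distinct (events_binders \<xi>)"

definition T_of where "T_of I k i = fst (ker (k i I))"
definition E_of where "E_of I k i = snd (ker (k i I))"
definition U_of where "U_of \<xi> k i = fst (ker (k i (actor \<xi> i)))"
definition F_of where "F_of \<xi> k i = snd (ker (k i (actor \<xi> i)))"

definition C_of ::
  "('f, 'n, 'v) dy_theory \<Rightarrow> 'n \<Rightarrow> ('f, 'n, 'v, 'p) event list \<Rightarrow> ('f, 'n, 'v, 'p) knowledge \<Rightarrow>
   ('f, 'n, 'v) trm set" where
  "C_of G I \<xi> k =
    (\<Union>i\<in>{0..length \<xi>}. (\<Union>t\<in>T_of I k i. st t) \<union> (\<Union>a\<in>E_of I k i. ast G a)) \<union>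
    (\<Union>i\<in>{1..length \<xi>}. (\<Union>t\<in>U_of \<xi> k i. st t) \<union> (\<Union>a\<in>F_of \<xi> k i. ast G a))"

definition D_of ::
  "('f, 'n, 'v) dy_theory \<Rightarrow> 'n \<Rightarrow> ('f, 'n, 'v, 'p) event list \<Rightarrow> ('f, 'n, 'v, 'p) knowledge \<Rightarrow>
   ('f, 'n, 'v) trm set" where
  "D_of G I \<xi> k = C_of G I \<xi> k - range Var"

definition typed ::
  "('f, 'n, 'v) dy_theory \<Rightarrow> ('f, 'n, 'v) sbst \<Rightarrow> ('f, 'n, 'v) trm set \<Rightarrow> ('f, 'n, 'v) dyproof \<Rightarrow> bool"
where
  "typed G \<sigma> D \<pi> \<longleftrightarrow>
    (\<forall>\<pi>'\<in>subproofs \<pi>. is_Con \<pi>' \<or> concl \<pi>' \<in> tsubst \<sigma> ` D \<union> Var ` qvars G)"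

end

theory Submission
  imports Defs
begin

text \<open>A normal proof can only be untyped at a conclusion \<open>t\<close> that occurs in some \<open>\<sigma>(y)\<close> with \<open>y\<close> an
  intruder variable.  Take the first received assertion \<open>\<beta>\<^sub>j\<close> in which such a \<open>y\<close> is free.  The intruder
  derived \<open>\<sigma>(\<beta>\<^sub>j)\<close> although \<open>t\<close> does not occur in what he knew: every variable sent was received
  before.  Along assertion derivations, both sides of every equality remain derivable and every
  new ground subterm is derivable, so the intruder could derive \<open>t\<close>, and since \<open>t\<close> is new to him, a
  normal proof of it ends in a constructor.  Its immediate subproofs can be made typed by induction on
  \<open>j\<close>, and the result replaces the untyped subproof.  If this creates a redex of a destructor on a
  constructor, the redex is contracted to the typed proof of the argument.\<close>

section \<open>Substitutions and subterms\<close>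

lemma tsubst_simps [simp]:
  "tsubst s (Var x) = (case s x of None \<Rightarrow> Var x | Some t \<Rightarrow> t)"
  "tsubst s (Nm m) = Nm m"
  "tsubst s (Fun f ts) = Fun f (map (tsubst s) ts)"
  by (simp_all add: tsubst_def)

lemma tsubst_ident: "(\<And>x. x \<in> vars t \<Longrightarrow> s x = None) \<Longrightarrow> tsubst s t = t"
  by (induction t) (auto intro!: map_idI)

lemma tsubst_single_ident: "x \<notin> vars t \<Longrightarrow> tsubst [x \<mapsto> r] t = t"
  by (rule tsubst_ident) auto

lemma fun_upd_None_ident: "x \<notin> dom s \<Longrightarrow> s(x := None) = s"
  by (auto simp: domIff)

lemma asubst_ident: "(\<And>x. x \<in> fv a \<Longrightarrow> s x = None) \<Longrightarrow> asubst s a = a"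
  by (induction a arbitrary: s) (auto intro!: map_idI tsubst_ident)

lemma inst_inst: "inst s (inst s' t) = inst (\<lambda>x. inst s (s' x)) t"
  by (induction t) auto

lemma vars_tsubst: "vars (tsubst s t) = (\<Union>x\<in>vars t. vars (tsubst s (Var x)))"
  by (induction t) auto

lemma st_refl [simp]: "t \<in> st t"
  by (cases t) auto

lemma st_vars: "u \<in> st t \<Longrightarrow> vars u \<subseteq> vars t"
  by (induction t) auto

lemma Var_in_st: "Var x \<in> st t \<longleftrightarrow> x \<in> vars t"
  by (induction t) auto

lemma st_trans: "u \<in> st t \<Longrightarrow> v \<in> st u \<Longrightarrow> v \<in> st t"
  by (induction t) auto

text \<open>Supplies the dichotomy behind typing: the first alternative will yield instances of
  \<open>D_of\<close>, and only the second, inside the value of a variable, can yield an untyped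
  conclusion.\<close>

lemma st_tsubst_cases:
  assumes "u \<in> st (tsubst s t)"
  obtains v where "v \<in> st t" "v \<notin> range Var" "u = tsubst s v"
  | y where "y \<in> vars t" "u \<in> st (tsubst s (Var y))"
  using assms
proof (induction t arbitrary: thesis)
  case (Nm m)
  then show ?case by (metis insertI1 rangeE singletonD st.simps(2) trm.distinct(1) tsubst_simps(2))
next
  case (Fun f ts)
  show ?case
  proof (cases "u = tsubst s (Fun f ts)")
    case True
    then show ?thesis using Fun.prems(1)[of "Fun f ts"] by auto
  next
    case False
    then obtain t where t: "t \<in> set ts" "u \<in> st (tsubst s t)" using Fun.prems(3) by auto
    show ?thesis
      by (rule Fun.IH[OF t(1) _ _ t(2)]) (use t(1) Fun.prems(1,2) in auto)
  qed
qed auto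

lemma tsubst_in_st_tsubst: "v \<in> st t \<Longrightarrow> tsubst s v \<in> st (tsubst s t)"
  by (induction t) (auto simp del: tsubst_simps(1))

lemma st_tsubst_Var: "y \<in> vars t \<Longrightarrow> st (tsubst s (Var y)) \<subseteq> st (tsubst s t)"
  by (meson Var_in_st st_trans subsetI tsubst_in_st_tsubst)

lemma ground_st_tsubst: "u \<in> st t \<Longrightarrow> vars u = {} \<Longrightarrow> u \<in> st (tsubst s t)"
  by (metis empty_iff tsubst_ident tsubst_in_st_tsubst)

lemma wf_tsubst: "wf_trm G t \<Longrightarrow> (\<And>x. x \<in> vars t \<Longrightarrow> wf_trm G (tsubst s (Var x))) \<Longrightarrow> wf_trm G (tsubst s t)"
  by (induction t) auto

lemma wf_atom: "is_atom t \<Longrightarrow> wf_trm G t"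
  by (auto simp: is_atom_def)


section \<open>Derivability of terms\<close>

lemma subproofs_refl [simp]: "\<pi> \<in> subproofs \<pi>"
  by (cases \<pi>) auto

lemma valid_mono: "valid G X \<pi> \<Longrightarrow> X \<subseteq> X' \<Longrightarrow> valid G X' \<pi>"
  by (induction \<pi>) auto

lemma dy_mono: "dy G X t \<Longrightarrow> X \<subseteq> X' \<Longrightarrow> dy G X' t"
  unfolding dy_def proves_def using valid_mono by blast

lemma dy_ax: "t \<in> X \<Longrightarrow> dy G X t"
  unfolding dy_def proves_def by (rule HOL.exI[of _ "Axm t"]) auto

lemma dy_list:
  assumes "\<forall>t\<in>set ts. dy G X t"
  shows "\<exists>ps. (\<forall>p\<in>set ps. valid G X p) \<and> map concl ps = ts"
  using assms
proof (induction ts)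
  case (Cons t ts)
  then obtain ps p where "\<forall>p\<in>set ps. valid G X p" "map concl ps = ts" "valid G X p" "concl p = t"
    by (auto simp: dy_def proves_def)
  then show ?case by (intro HOL.exI[of _ "p # ps"]) auto
qed auto

lemma dy_Fun:
  assumes "length ts = arity G f" "\<forall>t\<in>set ts. dy G X t"
  shows "dy G X (Fun f ts)"
proof -
  obtain ps where "\<forall>p\<in>set ps. valid G X p" "map concl ps = ts"
    using dy_list[OF assms(2)] by auto
  then show ?thesis using assms(1) unfolding dy_def proves_def
    by (intro HOL.exI[of _ "Con f ps"]) auto
qed

text \<open>Destructor rules are schemata: composing the matching substitution \<tau> with
  \<open>s\<close> turns each destructor step into another one, and each axiom is replaced by a
  given proof.\<close>

lemma dy_tsubst:
  assumes "dy G X t" "\<And>u. u \<in> X \<Longrightarrow> dy G Y (tsubst s u)"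
  shows "dy G Y (tsubst s t)"
proof -
  have "valid G X \<pi> \<Longrightarrow> dy G Y (tsubst s (concl \<pi>))" for \<pi>
  proof (induction \<pi>)
    case (Axm t)
    then show ?case using assms(2) by auto
  next
    case (Con f ps)
    then show ?case by (auto intro!: dy_Fun)
  next
    case (Des t p ps)
    let ?\<rho> = "\<lambda>x. case s x of None \<Rightarrow> Var x | Some t \<Rightarrow> t"
    from Des.prems obtain f ts us j \<tau> where
      r: "(f, ts, us, j) \<in> drules G" "concl p = Fun f (map (inst \<tau>) ts)"
         "map concl ps = map (inst \<tau>) us" "t = inst \<tau> (ts ! j)"
      unfolding valid.simps by blast
    obtain p' where p': "valid G Y p'" "concl p' = tsubst s (concl p)"
      using Des by (auto simp: dy_def proves_def)
    have "\<forall>t\<in>set (map (\<lambda>q. tsubst s (concl q)) ps). dy G Y t" using Des by auto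
    from dy_list[OF this] obtain ps' where
      ps': "\<forall>p\<in>set ps'. valid G Y p" "map concl ps' = map (\<lambda>q. tsubst s (concl q)) ps" by auto
    have eq: "tsubst s (inst \<tau> u) = inst (\<lambda>x. inst ?\<rho> (\<tau> x)) u" for u
      by (simp add: tsubst_def inst_inst)
    have "map concl ps' = map (tsubst s) (map concl ps)" using ps' by simp
    also have "\<dots> = map (inst (\<lambda>x. inst ?\<rho> (\<tau> x))) us" unfolding r(3) by (simp add: eq)
    finally have m: "map concl ps' = map (inst (\<lambda>x. inst ?\<rho> (\<tau> x))) us" .
    have c: "concl p' = Fun f (map (inst (\<lambda>x. inst ?\<rho> (\<tau> x))) ts)"
      using p'(2) r(2) by (simp add: eq)
    have "valid G Y (Des (tsubst s t) p' ps')"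
      unfolding valid.simps using r(1,4) m c p'(1) ps'(1) eq by blast
    moreover have "concl (Des (tsubst s t) p' ps') = tsubst s (concl (Des t p ps))" by simp
    ultimately show ?case unfolding dy_def proves_def by blast
  qed
  then show ?thesis using assms(1) by (auto simp: dy_def proves_def)
qed

lemma normal_Con [simp]: "normal (Con f ps) \<longleftrightarrow> (\<forall>p\<in>set ps. normal p)"
  by (auto simp: normal_def)

lemma normal_Axm [simp]: "normal (Axm t)"
  by (auto simp: normal_def)

lemma normal_Des [simp]: "normal (Des t p ps) \<longleftrightarrow> \<not> is_Con p \<and> normal p \<and> (\<forall>q\<in>set ps. normal q)"
  unfolding normal_def by (auto; blast)

lemma typed_Con [simp]: "typed G s D (Con f ps) \<longleftrightarrow> (\<forall>p\<in>set ps. typed G s D p)"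
  by (auto simp: typed_def)

lemma typed_Axm [simp]: "typed G s D (Axm t) \<longleftrightarrow> t \<in> tsubst s ` D \<union> Var ` qvars G"
  by (auto simp: typed_def)

lemma typed_Des [simp]: "typed G s D (Des t p ps) \<longleftrightarrow>
    t \<in> tsubst s ` D \<union> Var ` qvars G \<and> typed G s D p \<and> (\<forall>q\<in>set ps. typed G s D q)"
  by (auto simp: typed_def)

lemma normal_nonCon_concl:
  assumes "wf_dy_theory G" "\<forall>s\<in>X. wf_trm G s" "valid G X \<pi>" "normal \<pi>" "\<not> is_Con \<pi>"
  shows "concl \<pi> \<in> (\<Union>s\<in>X. st s)"
proof -
  have "concl ` subproofs \<pi> \<subseteq> (\<Union>s\<in>X. st s)"
    using assms(1)[unfolded wf_dy_theory_def, THEN conjunct2, THEN conjunct2, THEN conjunct2,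
        THEN spec[of _ X], THEN spec[of _ "concl \<pi>"], THEN spec[of _ \<pi>]] assms(2-5)
    by (simp add: proves_def)
  then show ?thesis using subproofs_refl by blast
qed

lemma dy_normal:
  assumes "wf_dy_theory G" "\<forall>s\<in>X. wf_trm G s" "dy G X t"
  obtains \<pi> where "valid G X \<pi>" "concl \<pi> = t" "normal \<pi>"
  using assms(1)[unfolded wf_dy_theory_def, THEN conjunct2, THEN conjunct2, THEN conjunct1,
      THEN spec[of _ X], THEN spec[of _ t]] assms(2,3) that
  by (auto simp: proves_def)

text \<open>A normal proof of \<open>u\<close> is followed upwards through constructors only.
  Conclusions of axioms and destructors have all their subterms among those of \<open>X\<close>, so
  \<open>t\<close> must itself be the conclusion of a constructor step on the way.\<close>

lemma dy_new_subterm: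
  assumes "wf_dy_theory G" "\<forall>s\<in>X. wf_trm G s" "dy G X u" "t \<in> st u" "t \<notin> (\<Union>s\<in>X. st s)"
  shows "dy G X t"
proof -
  have "valid G X \<pi> \<Longrightarrow> normal \<pi> \<Longrightarrow> t \<in> st (concl \<pi>) \<Longrightarrow> dy G X t" for \<pi>
  proof (induction \<pi>)
    case (Axm s)
    then show ?case using assms(5) by auto
  next
    case (Con f ps)
    show ?case
    proof (cases "t = concl (Con f ps)")
      case True
      then show ?thesis using Con.prems(1) unfolding dy_def proves_def by blast
    next
      case False
      then show ?thesis using Con by auto
    qed
  next
    case (Des s p ps)
    have "concl (Des s p ps) \<in> (\<Union>s\<in>X. st s)"
      by (rule normal_nonCon_concl[OF assms(1,2) Des.prems(1,2)]) simp
    then show ?case using Des.prems(3) assms(5) st_trans by blast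
  qed
  then show ?thesis using dy_normal[OF assms(1-3)] assms(4) by metis
qed

text \<open>If nothing else is known, a variable cannot be replaced by a known term; then no destructor
  rule is applicable at all.\<close>

lemma dy_ground_drop_vars:
  assumes wf: "wf_dy_theory G" and S: "\<forall>s\<in>S. vars s = {}"
    and t: "dy G (S \<union> Var ` Q) t" "vars t = {}"
  shows "dy G S t"
proof (cases "S = {}")
  case True
  have wfQ: "\<forall>s\<in>S \<union> Var ` Q. wf_trm G s" using True by auto
  have "valid G (S \<union> Var ` Q) \<pi> \<Longrightarrow> normal \<pi> \<Longrightarrow> vars (concl \<pi>) = {} \<Longrightarrow> dy G S (concl \<pi>)" for \<pi>
  proof (induction \<pi>)
    case (Axm s)
    then show ?case using True by auto
  next
    case (Con f ps)
    then show ?case by (auto intro!: dy_Fun)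
  next
    case (Des s p ps)
    then have "concl p \<in> (\<Union>s\<in>S \<union> Var ` Q. st s)"
      using normal_nonCon_concl[OF wf wfQ, of p] by auto
    then show ?case using Des.prems(1) True by auto
  qed
  then show ?thesis using dy_normal[OF wf wfQ t(1)] t(2) by metis
next
  case False
  then obtain s0 where s0: "s0 \<in> S" by auto
  \<comment> \<open>Sending every variable to the ground term \<open>s0\<close> fixes
    \<open>S\<close> and \<open>t\<close>, and turns the variables from \<open>Q\<close> into a
    member of \<open>S\<close>.\<close>
  have "dy G S (tsubst (\<lambda>x. Some s0) t)"
  proof (rule dy_tsubst[OF t(1)])
    fix u assume "u \<in> S \<union> Var ` Q"
    then show "dy G S (tsubst (\<lambda>x. Some s0) u)"
      using S s0 tsubst_ident[of u] by (auto intro!: dy_ax)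
  qed
  then show ?thesis using tsubst_ident[of t] t(2) by auto
qed


section \<open>Replacement and renaming in assertions\<close>

lemma below_simps [simp]:
  "below i {} = {}"
  "below i (A \<union> B) = below i A \<union> below i B"
  "below i ((#) j ` A) = (if i = j then A else {})"
  by (auto simp: below_def)

lemma vposs_simps [simp]:
  "vposs x (Var y) = (if x = y then {[]} else {})"
  "vposs x (Nm m) = {}"
  "vposs x (Fun f ts) = (\<Union>i<length ts. (#) i ` vposs x (ts ! i))"
  by (auto simp: vposs_def)

lemma vposs_empty: "vposs x t = {} \<longleftrightarrow> x \<notin> vars t"
proof (induction t)
  case (Fun f ts)
  have "vposs x (Fun f ts) = {} \<longleftrightarrow> (\<forall>i<length ts. vposs x (ts ! i) = {})" by auto
  also have "\<dots> \<longleftrightarrow> (\<forall>t\<in>set ts. x \<notin> vars t)" using Fun by (simp add: all_set_conv_all_nth)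
  finally show ?case by simp
qed auto

lemma Nil_in_vposs: "[] \<in> vposs x t \<longleftrightarrow> t = Var x"
  by (cases t) auto

lemma map_upt_nth: "map (\<lambda>i. g (ts ! i)) [0..<length ts] = map g ts"
  by (rule nth_equalityI) simp_all

lemma below_vposs_Fun: "i < length ts \<Longrightarrow> below i (vposs x (Fun f ts)) = vposs x (ts ! i)"
  by (auto simp: below_def)

lemma repl_vposs: "repl t (vposs x t) r = tsubst [x \<mapsto> r] t"
proof (induction t)
  case (Fun f ts)
  have "[] \<notin> vposs x (Fun f ts)" by auto
  then have "repl (Fun f ts) (vposs x (Fun f ts)) r =
      Fun f (map (\<lambda>i. repl (ts ! i) (below i (vposs x (Fun f ts))) r) [0..<length ts])"
    by (simp del: vposs_simps)
  also have "\<dots> = Fun f (map (\<lambda>i. tsubst [x \<mapsto> r] (ts ! i)) [0..<length ts])"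
    using Fun by (simp add: below_vposs_Fun del: vposs_simps fun_upd_apply)
  also have "\<dots> = tsubst [x \<mapsto> r] (Fun f ts)"
    unfolding map_upt_nth[of "tsubst [x \<mapsto> r]"] by (simp only: tsubst_simps)
  finally show ?case .
qed auto

lemma repl_empty [simp]: "repl t {} r = t"
proof (induction t)
  case (Fun f ts)
  then have "repl (Fun f ts) {} r = Fun f (map (\<lambda>i. ts ! i) [0..<length ts])" by simp
  then show ?case by (simp only: map_nth)
qed simp_all

lemma arepl_empty [simp]: "arepl a {} r = a"
  by (induction a) (simp_all add: map_nth)

text \<open>Both operations ignore bound occurrences and neither renames binders, so the positional
  replacement in the quantifier rules becomes an ordinary substitution.\<close>

lemma arepl_fposs: "arepl a (fposs G x a) r = asubst [x \<mapsto> r] a"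
proof (induction a)
  case (Ex y a)
  have "asubst Map.empty a = a" by (simp add: asubst_ident)
  moreover have "x \<noteq> y \<Longrightarrow> [x \<mapsto> r](y := None) = [x \<mapsto> r]" by auto
  ultimately show ?case using Ex by (simp del: fun_upd_apply)
next
  case (Pred P us)
  have "below i (fposs G x (Pred P us :: ('a, 'b, 'c, 'd) asrt)) = vposs x (us ! i)" if "i < length us" for i
    using that by (auto simp: below_def)
  then have "arepl (Pred P us) (fposs G x (Pred P us :: ('a, 'b, 'c, 'd) asrt)) r =
      Pred P (map (\<lambda>i. tsubst [x \<mapsto> r] (us ! i)) [0..<length us])"
    by (simp add: repl_vposs del: fposs.simps fun_upd_apply)
  then show ?case unfolding map_upt_nth[of "tsubst [x \<mapsto> r]"] by (simp only: asubst.simps)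
next
  case (Says k a)
  have "below 0 (vposs x (Fun (pkop G) [k])) = vposs x k"
    using below_vposs_Fun[of 0 "[k]"] by simp
  then show ?case using Says by (simp add: repl_vposs del: fun_upd_apply vposs_simps)
qed (simp_all add: repl_vposs del: fun_upd_apply)

lemma fun_upd_single_None [simp]:
  "[x \<mapsto> r](y := None) = (if x = y then Map.empty else [x \<mapsto> r])"
  by auto

lemma asubst_empty [simp]: "asubst Map.empty a = a"
  by (simp add: asubst_ident)

lemma bv_simps [simp]:
  "bv (Eq t u) = {}" "bv (Pred P us) = {}" "bv (Mem t ns) = {}"
  "bv (Conj a b) = bv a \<union> bv b" "bv (Ex x a) = insert x (bv a)" "bv (Says k a) = bv a"
  by (auto simp: bv_def)

lemma tsubst_rename_back: "y \<notin> vars t \<Longrightarrow> tsubst [y \<mapsto> Var x] (tsubst [x \<mapsto> Var y] t) = t"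
  by (induction t) (auto intro!: map_idI)

lemma asubst_rename_back:
  "y \<notin> fv a \<union> bv a \<Longrightarrow> asubst [y \<mapsto> Var x] (asubst [x \<mapsto> Var y] a) = a"
  by (induction a) (auto intro!: map_idI asubst_ident simp: tsubst_rename_back)

lemma vars_rename:
  "vars (tsubst [x \<mapsto> Var y] t) = (if x \<in> vars t then insert y (vars t - {x}) else vars t)"
  by (induction t) (auto split: if_splits)

lemma fv_rename:
  "y \<notin> bv a \<Longrightarrow> fv (asubst [x \<mapsto> Var y] a) = (if x \<in> fv a then insert y (fv a - {x}) else fv a)"
  by (induction a) (auto simp: vars_rename split: if_splits)

lemma alpha_fv: "alpha G a b \<Longrightarrow> fv a = fv b"
  by (induction rule: alpha.induct) (auto simp: arepl_fposs fv_rename)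

lemma is_atom_tsubst:
  "is_atom t \<Longrightarrow> (\<And>x. x \<in> vars t \<Longrightarrow> is_atom (tsubst s (Var x))) \<Longrightarrow> is_atom (tsubst s t)"
  by (cases t) (auto simp: is_atom_def)

text \<open>Arguments of \<open>Pred\<close> and \<open>Mem\<close> must stay names or variables,
  hence the demand on the values; it holds for renamings and for the instantiation of a role in a
  session.\<close>

lemma wf_asrt_asubst:
  "wf_asrt G a \<Longrightarrow> (\<And>x. x \<in> fv a \<Longrightarrow> is_atom (tsubst s (Var x))) \<Longrightarrow> wf_asrt G (asubst s a)"
proof (induction a arbitrary: s)
  case (Ex x a)
  have "is_atom (tsubst (s(x := None)) (Var z))" if "z \<in> fv a" for z
    using Ex.prems(2)[of z] that by (cases "z = x") (auto simp: is_atom_def)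
  then show ?case using Ex.IH[of "s(x := None)"] Ex.prems(1)
    by (simp del: fun_upd_apply tsubst_simps)
next
  case (Pred P us)
  have "is_atom (tsubst s u)" if "u \<in> set us" for u
    by (rule is_atom_tsubst) (use Pred that in \<open>auto simp del: tsubst_simps\<close>)
  then show ?case by simp
next
  case (Mem t ns)
  then show ?case using is_atom_tsubst[of t s] by (simp del: tsubst_simps)
next
  case (Eq t u)
  then show ?case using wf_tsubst[of G t s] wf_tsubst[of G u s]
    by (simp add: wf_atom del: tsubst_simps)
next
  case (Says k a)
  then show ?case using wf_tsubst[of G k s] by (simp add: wf_atom del: tsubst_simps)
next
  case (Conj a b)
  then show ?case by (simp del: tsubst_simps)
qed

lemma alpha_wf: "alpha G a b \<Longrightarrow> wf_asrt G a = wf_asrt G b"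
proof (induction rule: alpha.induct)
  case (alpha_rename x y a)
  have "wf_asrt G a" if "wf_asrt G (asubst [x \<mapsto> Var y] a)"
    using wf_asrt_asubst[OF that, of "[y \<mapsto> Var x]"] asubst_rename_back[of y a x] alpha_rename
    by (auto simp: is_atom_def)
  moreover have "wf_asrt G (asubst [x \<mapsto> Var y] a)" if "wf_asrt G a"
    using wf_asrt_asubst[OF that, of "[x \<mapsto> Var y]"] by (auto simp: is_atom_def)
  ultimately show ?case using alpha_rename by (auto simp: arepl_fposs)
qed auto

lemma wf_bv: "wf_asrt G a \<Longrightarrow> bv a \<subseteq> qvars G"
  by (induction a) auto

text \<open>The second assumption excludes capture: binders of a well-formed assertion are
  quantified variables, and a value other than the variable itself contains none of these.\<close>

lemma fv_asubst:
  assumes "wf_asrt G a"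
    and "\<And>z. z \<in> fv a \<Longrightarrow> tsubst s (Var z) = Var z \<or> vars (tsubst s (Var z)) \<inter> qvars G = {}"
  shows "fv (asubst s a) = (\<Union>z\<in>fv a. vars (tsubst s (Var z)))"
  using assms
proof (induction a arbitrary: s)
  case (Ex x a)
  let ?s = "s(x := None)"
  have "tsubst ?s (Var z) = Var z \<or> vars (tsubst ?s (Var z)) \<inter> qvars G = {}" if "z \<in> fv a" for z
    using Ex.prems(2)[of z] that by (cases "z = x") auto
  with Ex have "fv (asubst ?s a) = (\<Union>z\<in>fv a. vars (tsubst ?s (Var z)))" by simp
  also have "\<dots> - {x} = (\<Union>z\<in>fv a - {x}. vars (tsubst ?s (Var z)))"
    using Ex.prems by fastforce
  also have "\<dots> = (\<Union>z\<in>fv a - {x}. vars (tsubst s (Var z)))" by auto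
  finally show ?case by simp
next
  case (Eq t u)
  show ?case using vars_tsubst[of s t] vars_tsubst[of s u] by auto
next
  case (Pred P us)
  have "vars (tsubst s u) = (\<Union>z\<in>vars u. vars (tsubst s (Var z)))" for u
    by (rule vars_tsubst)
  then show ?case by auto
next
  case (Mem t ns)
  show ?case using vars_tsubst[of s t] by auto
next
  case (Says k a)
  have "fv (asubst s a) = (\<Union>z\<in>fv a. vars (tsubst s (Var z)))" using Says by auto
  then show ?case using vars_tsubst[of s k] by auto
next
  case (Conj a b)
  have "fv (asubst s a) = (\<Union>z\<in>fv a. vars (tsubst s (Var z)))"
    "fv (asubst s b) = (\<Union>z\<in>fv b. vars (tsubst s (Var z)))" using Conj by auto
  then show ?case by auto
qed


section \<open>Terms occurring in derivable assertions\<close>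

lemma ground_ast_asubst: "t \<in> ast G a \<Longrightarrow> vars t = {} \<Longrightarrow> t \<in> ast G (asubst s a)"
proof (induction a arbitrary: s)
  case (Says k a)
  then show ?case using ground_st_tsubst[of t "Fun (pkop G) [k]" s] by auto
qed (auto intro: ground_st_tsubst)

text \<open>Renaming creates no ground subterm: a ground instance of a nonvariable subterm comes
  from a term without \<open>x\<close>, and the value of a variable is again a variable.\<close>

lemma ground_ast_rename:
  assumes "t \<in> ast G (asubst [x \<mapsto> Var y] a)" "vars t = {}"
  shows "t \<in> ast G a"
proof -
  have st: "t \<in> st u" if t: "t \<in> st (tsubst [x \<mapsto> Var y] u)" for u
    using t
  proof (cases rule: st_tsubst_cases)
    case (1 v)
    then have "x \<notin> vars v" using assms(2) by (auto simp: vars_rename split: if_splits)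
    then show ?thesis using 1 tsubst_single_ident by metis
  next
    case (2 z)
    then show ?thesis using assms(2) by (auto split: if_splits)
  qed
  show ?thesis using assms(1)
  proof (induction a)
    case (Says k a)
    then show ?case using st[of "Fun (pkop G) [k]"] by (auto simp del: fun_upd_apply)
  next
    case (Ex z a)
    then show ?case using assms(2) by (auto simp del: fun_upd_apply split: if_splits)
  qed (use st in \<open>auto simp del: fun_upd_apply\<close>)
qed

lemma ground_ast_rename_iff:
  "vars t = {} \<Longrightarrow> t \<in> ast G (asubst [x \<mapsto> Var y] a) \<longleftrightarrow> t \<in> ast G a"
  using ground_ast_asubst ground_ast_rename by metis

lemma ground_ast_alpha: "alpha G a b \<Longrightarrow> vars t = {} \<Longrightarrow> t \<in> ast G a \<longleftrightarrow> t \<in> ast G b"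
  by (induction rule: alpha.induct) (auto simp: arepl_fposs ground_ast_rename_iff)

text \<open>The invariant of assertion derivations. \<open>Pred\<close> and \<open>Says\<close>
  carry no condition, since no rule extracts an equality or a membership from them. A bound variable
  must be in \<open>Z\<close> so that its scope can be judged with respect to \<open>Z\<close>
  itself.\<close>

fun sides_derivable ::
  "('f, 'n, 'v) dy_theory \<Rightarrow> ('f, 'n, 'v) trm set \<Rightarrow> ('f, 'n, 'v, 'p) asrt \<Rightarrow> bool" where
  "sides_derivable G Z (Eq t u) = (dy G Z t \<and> dy G Z u)"
| "sides_derivable G Z (Pred P us) = True"
| "sides_derivable G Z (Mem t ns) = (dy G Z t \<and> (\<forall>m\<in>set ns. dy G Z (Nm m)))"
| "sides_derivable G Z (Conj a b) = (sides_derivable G Z a \<and> sides_derivable G Z b)"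
| "sides_derivable G Z (Ex x a) = (Var x \<in> Z \<and> sides_derivable G Z a)"
| "sides_derivable G Z (Says k a) = True"

lemma sides_derivable_asubst:
  assumes "sides_derivable G Z a" "\<And>u. u \<in> Z \<Longrightarrow> dy G Z (tsubst [x \<mapsto> r] u)"
  shows "sides_derivable G Z (asubst [x \<mapsto> r] a)"
proof -
  have "dy G Z u \<Longrightarrow> dy G Z (tsubst [x \<mapsto> r] u)" for u
    using dy_tsubst assms(2) by blast
  then show ?thesis using assms(1) by (induction a) auto
qed

lemma abstr_trm_dy: "p \<in> abstr_trm G S t \<Longrightarrow> dy G S t"
  by (auto simp: abstr_trm_def)

text \<open>The proper prefix \<open>[]\<close> of \<open>[j]\<close> contributes the position
  \<open>[j]\<close> itself to \<open>?Q\<close>, which makes the argument derivable.\<close>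

lemma abstr_trm_arg:
  assumes "[j] \<in> abstr_trm G S (Fun f ts)"
  shows "dy G S (ts ! j)"
proof -
  let ?t = "Fun f ts" and ?Q = "{[]} \<union> {q @ [i] | q i. q @ [i] \<in> poss (Fun f ts) \<and> (\<exists>r. r \<noteq> [] \<and> [j] = q @ r)}"
  have "[j] \<in> poss ?t" "\<forall>q\<in>?Q. dy G S (subt_at ?t q)"
    using assms unfolding abstr_trm_def by blast+
  moreover from this(1) have "[j] \<in> ?Q"
    by (intro UnI2 CollectI HOL.exI[of _ "[]"] HOL.exI[of _ j]) simp
  ultimately have "dy G S (subt_at ?t [j])" by blast
  then show ?thesis by simp
qed

lemma Cons_image_subset_iff:
  fixes i j :: nat
  assumes "i \<noteq> j"
  shows "(#) i ` A \<subseteq> (#) i ` A' \<union> (#) j ` B \<longleftrightarrow> A \<subseteq> A'"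
    and "(#) i ` A \<subseteq> (#) j ` B \<union> (#) i ` A' \<longleftrightarrow> A \<subseteq> A'"
  using assms by auto

text \<open>This is what the side condition of \<open>exI\<close> is for. If \<open>x\<close> occurs
  in a side of an equality, an abstractable occurrence forces the whole side, at position
  \<open>[]\<close>, to be derivable; otherwise the substitution leaves the side unchanged. Under a
  quantifier \<open>S\<close> grows by a variable that lies in \<open>Z\<close>.\<close>

lemma sides_derivable_abstract:
  assumes "sides_derivable G Z (asubst [x \<mapsto> r] a)" "fposs G x a \<subseteq> abstr G S a" "S \<subseteq> Z" "Var x \<in> Z"
  shows "sides_derivable G Z a"
proof -
  have side: "dy G Z u"
    if "vposs x u \<subseteq> abstr_trm G S u" "dy G Z (tsubst [x \<mapsto> r] u)" "S \<subseteq> Z" for u S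
  proof (cases "x \<in> vars u")
    case True
    then obtain p where "p \<in> vposs x u" using vposs_empty[of x u] by auto
    then have "p \<in> abstr_trm G S u" using that(1) by blast
    then show ?thesis using abstr_trm_dy dy_mono that(3) by metis
  next
    case False
    then show ?thesis using that(2) tsubst_single_ident by metis
  qed
  show ?thesis using assms(1-3)
  proof (induction a arbitrary: S)
    case (Eq t u)
    then show ?case using side[of t S] side[of u S]
      by (simp add: Cons_image_subset_iff del: fun_upd_apply)
  next
    case (Mem t ns)
    show ?case
    proof (cases "x \<in> vars t")
      case True
      then obtain p where p: "p \<in> vposs x t" using vposs_empty[of x t] by auto
      \<comment> \<open>No position below the root of \<open>t\<close> is abstractable in a
        \<open>Mem\<close>, so \<open>x\<close> can only be the whole of \<open>t\<close>, and
        \<open>Var x\<close> lies in \<open>Z\<close>.\<close>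
      with Mem.prems(2) have "0 # p \<in> {[0]}" by force
      with p have "t = Var x" using Nil_in_vposs[of x t] by simp
      then show ?thesis using Mem.prems(1) assms(4) by (simp add: dy_ax)
    next
      case False
      then show ?thesis using Mem.prems(1) by (simp add: tsubst_single_ident del: fun_upd_apply)
    qed
  next
    case (Conj a b)
    then show ?case
      using Conj.IH(1)[of S] Conj.IH(2)[of S] by (simp add: Cons_image_subset_iff del: fun_upd_apply)
  next
    case (Ex y a)
    show ?case
    proof (cases "x = y")
      case True
      then show ?thesis using Ex.prems by (auto simp del: fun_upd_apply)
    next
      case False
      have "fposs G x a \<subseteq> abstr G (S \<union> {Var y}) a"
        using Ex.prems(2) False by auto
      moreover have "Var y \<in> Z" using Ex.prems(1) by simp
      ultimately have "sides_derivable G Z a" "Var y \<in> Z"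
        using Ex.prems(1,3) Ex.IH[of "S \<union> {Var y}"] False by (simp_all del: fun_upd_apply)
      then show ?thesis by auto
    qed
  qed simp_all
qed

text \<open>Renaming to a quantified variable maps \<open>Z\<close> into itself and is undone by
  another such renaming; the binder condition holds for all quantified variables alike.\<close>

lemma alpha_sides_derivable:
  assumes "alpha G a b"
    and Z: "\<And>x y u. y \<in> qvars G \<Longrightarrow> u \<in> Z \<Longrightarrow> tsubst [x \<mapsto> Var y] u \<in> Z" "Var ` qvars G \<subseteq> Z"
  shows "sides_derivable G Z a = sides_derivable G Z b"
  using assms(1)
proof (induction rule: alpha.induct)
  case (alpha_rename x y a)
  have "sides_derivable G Z a" if "sides_derivable G Z (asubst [x \<mapsto> Var y] a)"
    using sides_derivable_asubst[OF that, of y "Var x"] Z(1) alpha_rename asubst_rename_back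
    by (metis dy_ax)
  moreover have "sides_derivable G Z (asubst [x \<mapsto> Var y] a)" if "sides_derivable G Z a"
    using sides_derivable_asubst[OF that, of x "Var y"] Z(1) alpha_rename by (metis dy_ax)
  ultimately show ?case using alpha_rename Z(2) by (auto simp: arepl_fposs)
qed auto

text \<open>Passing from \<open>S\<close> to \<open>Z \<supseteq> S \<union> Var ` qvars\<close> makes the invariant stable under the
  extensions of \<open>S\<close> in the rules for the quantifier.\<close>

lemma aderiv_terms:
  assumes "aderiv G full S A a" "wf_dy_theory G" "\<forall>s\<in>Z. wf_trm G s"
    and Z: "\<And>x y u. y \<in> qvars G \<Longrightarrow> u \<in> Z \<Longrightarrow> tsubst [x \<mapsto> Var y] u \<in> Z" "Var ` qvars G \<subseteq> Z"
    and M: "(\<Union>s\<in>Z. st s) \<subseteq> M"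
    and "S \<subseteq> Z"
    and "\<And>b. b \<in> A \<Longrightarrow> sides_derivable G Z b \<and> (\<forall>t\<in>ast G b. vars t = {} \<longrightarrow> t \<in> M \<or> dy G Z t)"
  shows "sides_derivable G Z a \<and> (\<forall>t\<in>ast G a. vars t = {} \<longrightarrow> t \<in> M \<or> dy G Z t)"
proof -
  \<comment> \<open>\<open>M\<close> contains all subterms of \<open>Z\<close>, so a subterm of a
    derivable term that lies outside \<open>M\<close> is new and hence derivable.\<close>
  have new: "t \<in> M \<or> dy G Z t" if "dy G Z u" "t \<in> st u" for t u
    using dy_new_subterm[OF assms(2,3) that] M by blast
  show ?thesis using assms(1,7,8)
  proof (induction rule: aderiv.induct)
    case (ax a A S)
    then show ?case by blast
  next
    case (ren S A a b)
    then show ?case using alpha_sides_derivable[OF _ Z] ground_ast_alpha by metis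
  next
    case (eq S t A)
    then show ?case using dy_mono new by (metis Un_iff ast.simps(1) sides_derivable.simps(1))
  next
    case (cons ts f us S A)
    have IH: "sides_derivable G Z (Eq (ts ! j) (us ! j)) \<and>
        (\<forall>t\<in>st (ts ! j) \<union> st (us ! j). vars t = {} \<longrightarrow> t \<in> M \<or> dy G Z t)" if "j < length ts" for j
      using cons that by auto
    then have d: "dy G Z (Fun f ts)" "dy G Z (Fun f us)"
      using cons.hyps(1,2) by (auto intro!: dy_Fun simp: in_set_conv_nth)
    have "t \<in> M \<or> dy G Z t" if t: "t \<in> ast G (Eq (Fun f ts) (Fun f us))" "vars t = {}" for t
    proof -
      consider "t = Fun f ts" | "t = Fun f us" | j where "j < length ts" "t \<in> st (ts ! j) \<union> st (us ! j)"
        using t(1) cons.hyps(1,2) by (auto simp: in_set_conv_nth)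
      then show ?thesis using d IH t(2) by cases auto
    qed
    then show ?case using d by simp
  next
    case (sym S A t u)
    show ?case using sym.IH[OF sym.prems] by auto
  next
    case (trans k ts S A)
    have IH: "dy G Z (ts ! j) \<and> dy G Z (ts ! Suc j) \<and>
      (\<forall>t\<in>st (ts ! j) \<union> st (ts ! Suc j). vars t = {} \<longrightarrow> t \<in> M \<or> dy G Z t)" if "j < k" for j
      using conjunct2[OF trans.IH[rule_format, OF that]] trans.prems by simp
    have "Suc (k - 1) = k" using trans.hyps(1) by simp
    then show ?case using IH[of 0] IH[of "k - 1"] trans.hyps(1) by auto
  next
    case (proj S A f ts us i)
    have "[0, i] \<in> abstr G S (Eq (Fun f ts) (Fun f us) :: ('a, 'b, 'c, 'd) asrt)"
         "[1, i] \<in> abstr G S (Eq (Fun f ts) (Fun f us) :: ('a, 'b, 'c, 'd) asrt)"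
      using proj.hyps by auto
    \<comment> \<open>Derivability of a compound term does not give that of its arguments; the side
      condition of the rule does.\<close>
    then have "[i] \<in> abstr_trm G S (Fun f ts)" "[i] \<in> abstr_trm G S (Fun f us)" by auto
    then have "dy G Z (ts ! i)" "dy G Z (us ! i)" using abstr_trm_arg dy_mono proj.prems(1) by metis+
    moreover have "ts ! i \<in> set ts" "us ! i \<in> set us" using proj.hyps by auto
    ultimately show ?case using proj.IH[OF proj.prems] by auto
  next
    case (subst S A t l u)
    show ?case using subst.IH(1)[OF subst.prems] subst.IH(2)[OF subst.prems] by auto
  next
    case (prom S A t m)
    show ?case using prom.IH[OF prom.prems] by auto
  next
    case (int ls S A t l')
    \<comment> \<open>\<open>ls\<close> is nonempty, and any one member bounds the
      intersection.\<close>
    then obtain l where "l \<in> set ls" by (meson list.set_sel(1))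
    moreover from this have "set l' \<subseteq> set l" using int.hyps by auto
    moreover have "sides_derivable G Z (Mem t l) \<and>
      (\<forall>t\<in>ast G (Mem t l :: ('a, 'b, 'c, 'd) asrt). vars t = {} \<longrightarrow> t \<in> M \<or> dy G Z t)"
      using conjunct2[OF int.IH[rule_format, OF \<open>l \<in> set ls\<close>]] int.prems by simp
    ultimately show ?case by auto
  next
    case (wk i l S A t)
    have "\<forall>m\<in>set l. dy G Z (Nm m)" using wk.hyps wk.prems(1) dy_mono by metis
    then show ?case using wk.IH[OF wk.prems] by auto
  next
    case (conjI S A a b)
    show ?case using conjI.IH(1)[OF conjI.prems] conjI.IH(2)[OF conjI.prems] by auto
  next
    case (conjE0 S A a b)
    show ?case using conjE0.IH[OF conjE0.prems] by auto
  next
    case (conjE1 S A a b)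
    show ?case using conjE1.IH[OF conjE1.prems] by auto
  next
    case (exI x P a t S A)
    then have x: "Var x \<in> Z" using Z(2) by auto
    have IH: "sides_derivable G Z (asubst [x \<mapsto> t] a)"
      "\<forall>u\<in>ast G (asubst [x \<mapsto> t] a). vars u = {} \<longrightarrow> u \<in> M \<or> dy G Z u"
      using exI.IH[OF exI.prems] unfolding exI.hyps(3) arepl_fposs by blast+
    have "sides_derivable G Z a"
      by (rule sides_derivable_abstract[OF IH(1), of "S \<union> {Var x}"]) (use exI.hyps(3,7) exI.prems(1) x in auto)
    \<comment> \<open>A ground subterm of \<open>a\<close> survives the instantiation of
      \<open>x\<close>, so the bound for the instance covers \<open>a\<close>.\<close>
    then show ?case using x IH(2) ground_ast_asubst by fastforce
  next
    case (exE S A x a P y c)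
    have IH: "sides_derivable G Z a" "\<forall>t\<in>ast G a. vars t = {} \<longrightarrow> t \<in> M \<or> dy G Z t"
      using exE.IH(1)[OF exE.prems] by auto
    have "sides_derivable G Z (asubst [x \<mapsto> Var y] a)"
      by (rule sides_derivable_asubst[OF IH(1)]) (use Z(1) exE.hyps in \<open>auto intro: dy_ax\<close>)
    moreover have "\<forall>t\<in>ast G (asubst [x \<mapsto> Var y] a). vars t = {} \<longrightarrow> t \<in> M \<or> dy G Z t"
      using IH(2) ground_ast_rename by metis
    \<comment> \<open>The fresh variable is quantified and so already lies in \<open>Z\<close>: the
      enlarged \<open>S\<close> stays within it.\<close>
    moreover have "S \<union> {Var y} \<subseteq> Z" using exE.hyps(4) exE.prems(1) Z(2) by auto
    ultimately show ?case using exE.prems(2) unfolding arepl_fposs exE.hyps(3)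
      by (intro exE.IH(2)[unfolded exE.hyps(3) arepl_fposs]) blast+
  next
    case (say S A a k)
    have k: "dy G Z k" using say dy_mono by metis
    \<comment> \<open>The assertion gains the subterm \<open>pk(k)\<close>, one constructor step
      away from \<open>k\<close>.\<close>
    moreover have "dy G Z (Fun (pkop G) [k])"
      using k assms(2) by (auto intro!: dy_Fun simp: wf_dy_theory_def)
    ultimately have "\<forall>t\<in>st (Fun (pkop G) [k]). t \<in> M \<or> dy G Z t" using new by auto
    then show ?case using say.IH[OF say.prems] by auto
  qed
qed

text \<open>A term is assembled by constructors from its public parts, whose instances lie in
  \<open>Z\<close>, and from quantified variables, which \<open>s\<close> leaves fixed.\<close>

lemma dy_tpubs:
  assumes "wf_trm G t" "tsubst s ` tpubs G t \<subseteq> Z" "Var ` qvars G \<subseteq> Z" "dom s \<inter> qvars G = {}"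
  shows "dy G Z (tsubst s t)"
  using assms(1,2)
proof (induction t)
  case (Var x)
  show ?case
  proof (cases "x \<in> qvars G")
    case True
    then have "tsubst s (Var x) = Var x" using assms(4) by (auto split: option.split)
    then show ?thesis using True assms(3) by (auto intro: dy_ax)
  next
    case False
    then show ?thesis using Var.prems(2) by (simp add: dy_ax)
  qed
next
  case (Nm m)
  then show ?case by (simp add: dy_ax)
next
  case (Fun f ts)
  show ?case
  proof (cases "vars (Fun f ts) \<inter> qvars G = {}")
    case True
    then show ?thesis using Fun.prems(2) by (simp add: dy_ax)
  next
    case False
    then have "tsubst s ` tpubs G t \<subseteq> Z" if "t \<in> set ts" for t
      using Fun.prems(2) that by (auto split: if_splits)
    then show ?thesis using Fun by (auto intro!: dy_Fun)
  qed
qed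

text \<open>Starting point of the invariant: sending an assertion publishes its \<open>pubs\<close>,
  which suffice to derive the sides of its equalities.\<close>

lemma sides_derivable_pubs:
  assumes "wf_asrt G a" "tsubst s ` pubs G a \<subseteq> Z" "Var ` qvars G \<subseteq> Z" "dom s \<inter> qvars G = {}"
  shows "sides_derivable G Z (asubst s a)"
  using assms(1,2)
proof (induction a)
  case (Ex x a)
  then have "x \<notin> dom s" using assms(4) by auto
  then have "s(x := None) = s" by (rule fun_upd_None_ident)
  then show ?case using Ex assms(3) by auto
next
  case (Mem t ns)
  then have "dy G Z (Nm m)" if "m \<in> set ns" for m
    using that by (auto intro!: dy_ax simp: image_Un image_image)
  then show ?case using Mem dy_tpubs[OF wf_atom _ assms(3,4), of t] by (simp add: image_Un)
qed (auto intro!: dy_tpubs assms(3,4))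

lemma tpubs_vars: "u \<in> tpubs G t \<Longrightarrow> y \<in> vars u \<Longrightarrow> y \<in> vars t \<and> y \<notin> qvars G"
  by (induction t) (auto split: if_splits)

lemma pubs_vars: "u \<in> pubs G a \<Longrightarrow> wf_asrt G a \<Longrightarrow> y \<in> vars u \<Longrightarrow> y \<in> fv a \<and> y \<notin> qvars G"
proof (induction a)
  case (Says k a)
  then show ?case using tpubs_vars[of u G "Fun (pkop G) [k]" y] by auto
qed (auto dest: tpubs_vars)

lemma tpubs_wf: "u \<in> tpubs G t \<Longrightarrow> wf_trm G t \<Longrightarrow> wf_trm G u"
  by (induction t) (auto split: if_splits)

lemma pubs_wf:
  assumes "arity G (pkop G) = 1"
  shows "u \<in> pubs G a \<Longrightarrow> wf_asrt G a \<Longrightarrow> wf_trm G u"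
proof (induction a)
  case (Says k a)
  then show ?case using tpubs_wf[of u G "Fun (pkop G) [k]"] assms by auto
qed (auto dest: tpubs_wf wf_atom)

text \<open>Lifts \<open>st_tsubst_cases\<close> to assertions. As \<open>t\<close> is ground and
  \<open>s\<close> fixes the bound variables, the variable in the second alternative must be
  free.\<close>

lemma ast_asubst_cases:
  assumes "t \<in> ast G (asubst s a)" "vars t = {}" "wf_asrt G a" "dom s \<inter> qvars G = {}"
  shows "(\<exists>u. u \<in> ast G a \<and> u \<notin> range Var \<and> t = tsubst s u) \<or>
    (\<exists>y. y \<in> fv a \<and> t \<in> st (tsubst s (Var y)))"
proof -
  have st: "(\<exists>v. v \<in> st u \<and> v \<notin> range Var \<and> t = tsubst s v) \<or> (\<exists>y. y \<in> vars u \<and> t \<in> st (tsubst s (Var y)))"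
    if "t \<in> st (tsubst s u)" for u
    using st_tsubst_cases[OF that] by metis
  show ?thesis using assms(1,3)
  proof (induction a)
    case (Eq u v)
    then show ?case using st[of u] st[of v] by (auto simp del: tsubst_simps)
  next
    case (Pred P us)
    then obtain u where u: "u \<in> set us" "t \<in> st (tsubst s u)" by auto
    then show ?case using st[of u] by (auto simp del: tsubst_simps)
  next
    case (Mem u ns)
    then consider "t \<in> st (tsubst s u)" | m where "m \<in> set ns" "t = Nm m" by auto
    then show ?case
    proof cases
      case 1
      then show ?thesis using st[of u] by (auto simp del: tsubst_simps)
    next
      case 2
      then have "Nm m \<in> ast G (Mem u ns)" "Nm m \<notin> range Var" "t = tsubst s (Nm m)" by auto
      then show ?thesis by blast
    qed
  next
    case (Ex x a)
    then have "x \<notin> dom s" using assms(4) by auto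
  then have "s(x := None) = s" by (rule fun_upd_None_ident)
    then have IH: "(\<exists>u. u \<in> ast G a \<and> u \<notin> range Var \<and> t = tsubst s u) \<or>
        (\<exists>y. y \<in> fv a \<and> t \<in> st (tsubst s (Var y)))"
      using Ex assms(2) by (auto simp del: tsubst_simps)
    have "t \<notin> st (tsubst s (Var x))" using Ex.prems(2) assms(2,4) by (auto split: option.split)
    then show ?case using IH by (metis DiffI UnI2 ast.simps(5) fv.simps(5) singletonD)
  next
    case (Conj a b)
    then show ?case by (auto simp del: tsubst_simps)
  next
    case (Says k a)
    show ?case
    proof (cases "t \<in> ast G (asubst s a)")
      case True
      then show ?thesis using Says by (auto simp del: tsubst_simps)
    next
      case False
      then have "t \<in> st (tsubst s (Fun (pkop G) [k]))" using Says.prems(1) by simp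
      from st[OF this] show ?thesis by (auto simp del: tsubst_simps)
    qed
  qed
qed

text \<open>Splitting into atoms drops only the variables at the quantifiers, so nonvariable
  subterms reach the kernel and hence \<open>D_of\<close>.\<close>

lemma ast_atoms: "u \<in> ast G a \<Longrightarrow> u \<notin> range Var \<Longrightarrow> u \<in> (\<Union>c\<in>atoms a. ast G c)"
  by (induction a) auto

lemma st_fv_ast:
  assumes "y \<in> fv a" "wf_asrt G a" "dom s \<inter> qvars G = {}"
  shows "st (tsubst s (Var y)) \<subseteq> ast G (asubst s a)"
  using assms(1,2)
proof (induction a)
  case (Ex x a)
  then have "x \<notin> dom s" using assms(3) by auto
  then have "s(x := None) = s" by (rule fun_upd_None_ident)
  then show ?case using Ex by (auto simp del: tsubst_simps)
next
  case (Says k a)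
  then show ?case using st_tsubst_Var[of y "Fun (pkop G) [k]" s] by auto
qed (use st_tsubst_Var[of y] in fastforce)+


section \<open>Runs\<close>

lemma sent_var_received:
  assumes "x \<in> fv (snd (r ! j))" "j < length r" "x \<notin> agent_vars r"
  shows "\<exists>k\<le>j. x \<in> fv (fst (r ! k))"
proof -
  let ?P = "\<lambda>k. x \<in> fv (fst (r ! k)) \<union> fv (snd (r ! k))"
  \<comment> \<open>\<open>m\<close> is the first pair in which \<open>x\<close> occurs. Were
    \<open>x\<close> absent from its received part, it would be an agent variable.\<close>
  define m where "m = (LEAST k. ?P k)"
  have "?P j" using assms(1) by blast
  then have m: "?P m" "m \<le> j" "\<forall>k<m. \<not> ?P k"
    unfolding m_def by (rule LeastI, rule Least_le[of ?P], use not_less_Least in blast)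
  then have "x \<in> fv (fst (r ! m))"
    using assms(2,3) unfolding agent_vars_def by auto
  then show ?thesis using m(2) by blast
qed

text \<open>Locates an event of the run inside its session; what precedes it in the session also
  precedes it in the run. The index sought is the number of selected elements before
  \<open>i\<close>.\<close>

lemma nths_index:
  assumes "i < length xs" "i \<in> J"
  shows "\<exists>j<length (nths xs J). nths xs J ! j = xs ! i \<and> (\<forall>k\<le>j. \<exists>i'\<le>i. nths xs J ! k = xs ! i')"
proof -
  let ?ys = "nths (take i xs) J"
  have "take (Suc i) xs = take i xs @ [xs ! i]" using assms(1) by (rule take_Suc_conv_app_nth)
  then have "nths (take (Suc i) xs) J = ?ys @ [xs ! i]"
    using assms by (simp add: nths_append nths_singleton)
  moreover obtain zs where "nths xs J = nths (take (Suc i) xs) J @ zs"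
    using nths_append[of "take (Suc i) xs" "drop (Suc i) xs" J] unfolding append_take_drop_id by blast
  ultimately have eq: "nths xs J = ?ys @ [xs ! i] @ zs" by simp
  have "\<exists>i'\<le>i. nths xs J ! k = xs ! i'" if "k \<le> length ?ys" for k
  proof (cases "k = length ?ys")
    case False
    then have "nths xs J ! k \<in> set ?ys" using eq that by (simp add: nth_append)
    then have "nths xs J ! k \<in> set (take i xs)" using set_nths_subset by fastforce
    then show ?thesis using assms(1) by (auto simp: in_set_conv_nth intro: less_imp_le)
  qed (use eq in auto)
  then show ?thesis using eq by (intro HOL.exI[of _ "length ?ys"]) auto
qed

text \<open>Agent variables become names and intruder variables become unquantified variables, so
  well-formedness is kept. A free variable of a sent assertion therefore stems from an intruder
  variable, whose first occurrence is in a received assertion.\<close>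

lemma session_event:
  assumes "session G Ag Pr s" "protocol G Pr" "j < length s"
  shows "wf_asrt G (fst (snd (s ! j))) \<and> wf_asrt G (snd (snd (s ! j))) \<and>
    (\<forall>y\<in>fv (snd (snd (s ! j))). \<exists>k\<le>j. y \<in> fv (fst (snd (s ! k))))"
proof -
  obtain u r \<rho> where r: "r \<in> Pr" "length s \<le> length r"
    and ag: "\<forall>x\<in>agent_vars r. \<exists>m. \<rho> x = Some (Nm m)"
    and intr: "\<forall>x\<in>intruder_vars r. \<exists>y. \<rho> x = Some (Var y) \<and> y \<notin> qvars G"
    and ev: "\<forall>j<length s. \<exists>b a. s ! j = (u, b, a) \<and>
          alpha G (asubst \<rho> (fst (r ! j))) b \<and> alpha G (asubst \<rho> (snd (r ! j))) a"
    using assms(1) unfolding session_def by blast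
  have ev: "alpha G (asubst \<rho> (fst (r ! j))) (fst (snd (s ! j)))"
    "alpha G (asubst \<rho> (snd (r ! j))) (snd (snd (s ! j)))" if "j < length s" for j
    using ev that by fastforce+
  have wfr: "wf_asrt G (fst (r ! j)) \<and> wf_asrt G (snd (r ! j))" if "j < length r" for j
    using r(1) assms(2) nth_mem[OF that] unfolding protocol_def by fastforce
  have fvr: "fv (fst (r ! j)) \<union> fv (snd (r ! j)) \<subseteq> role_fv r" if "j < length r" for j
    using nth_mem[OF that] unfolding role_fv_def by fastforce
  have cases: "(\<exists>m. \<rho> x = Some (Nm m)) \<or> (x \<notin> agent_vars r \<and> (\<exists>y. \<rho> x = Some (Var y) \<and> y \<notin> qvars G))"
    if "x \<in> role_fv r" for x
    using ag intr that unfolding intruder_vars_def by blast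
  have atom: "is_atom (tsubst \<rho> (Var x))" "vars (tsubst \<rho> (Var x)) \<inter> qvars G = {}"
    if "x \<in> role_fv r" for x
    using cases[OF that] by (auto simp: is_atom_def)
  have sub: "wf_asrt G (asubst \<rho> c)" "fv (asubst \<rho> c) = (\<Union>z\<in>fv c. vars (tsubst \<rho> (Var z)))"
    if c: "wf_asrt G c" "fv c \<subseteq> role_fv r" for c :: "('a, 'b, 'c, 'd) asrt"
  proof -
    show "wf_asrt G (asubst \<rho> c)"
      by (rule wf_asrt_asubst[OF c(1)]) (use atom(1) c(2) in blast)
    show "fv (asubst \<rho> c) = (\<Union>z\<in>fv c. vars (tsubst \<rho> (Var z)))"
      by (rule fv_asubst[OF c(1)]) (use atom(2) c(2) in blast)
  qed
  have wf: "wf_asrt G (asubst \<rho> (fst (r ! j)))" "wf_asrt G (asubst \<rho> (snd (r ! j)))"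
    and fv: "fv (asubst \<rho> (fst (r ! j))) = (\<Union>z\<in>fv (fst (r ! j)). vars (tsubst \<rho> (Var z)))"
      "fv (asubst \<rho> (snd (r ! j))) = (\<Union>z\<in>fv (snd (r ! j)). vars (tsubst \<rho> (Var z)))"
    if "j < length s" for j
    using sub[of "fst (r ! j)"] sub[of "snd (r ! j)"] wfr[of j] fvr[of j] r(2) that by auto
  have "\<exists>k\<le>j. y \<in> fv (fst (snd (s ! k)))" if y: "y \<in> fv (snd (snd (s ! j)))" for y
  proof -
    from y obtain z where z: "z \<in> fv (snd (r ! j))" "y \<in> vars (tsubst \<rho> (Var z))"
      using alpha_fv[OF ev(2)] fv(2) assms(3) by blast
    have j: "j < length r" using assms(3) r(2) by simp
    have "z \<in> role_fv r" using fvr[OF j] z(1) by blast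
    \<comment> \<open>The value of an agent variable is a name and contains no
      \<open>y\<close>.\<close>
    then have "z \<notin> agent_vars r" using ag z(2) by fastforce
    then obtain k where k: "k \<le> j" "z \<in> fv (fst (r ! k))"
      using sent_var_received[OF z(1) j] by blast
    then have "y \<in> fv (fst (snd (s ! k)))"
      using alpha_fv[OF ev(1)[of k]] fv(1)[of k] assms(3) z(2) by auto
    then show ?thesis using k(1) by blast
  qed
  then show ?thesis using alpha_wf[OF ev(1)] alpha_wf[OF ev(2)] wf assms(3) by blast
qed

lemma run_event:
  assumes "run G Ag I Pr X \<xi> \<sigma> k" "protocol G Pr" "i \<in> {1..length \<xi>}"
  shows "wf_asrt G (recv \<xi> i)" "wf_asrt G (sent \<xi> i)"
    "y \<in> fv (sent \<xi> i) \<Longrightarrow> \<exists>j\<in>{1..i}. y \<in> fv (recv \<xi> j)"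
proof -
  obtain Ss where Ss: "\<forall>s\<in>Ss. session G Ag Pr s" "interleaving Ss \<xi>"
    using assms(1) unfolding run_def by blast
  then obtain c where c: "\<forall>i<length \<xi>. c i \<in> Ss" "\<forall>s\<in>Ss. nths \<xi> {i. c i = s} = s"
    unfolding interleaving_def by blast
  have i: "i - 1 < length \<xi>" using assms(3) by auto
  define s where "s = c (i - 1)"
  have s: "session G Ag Pr s" "nths \<xi> {i. c i = s} = s" using c i Ss(1) unfolding s_def by auto
  obtain j where j: "j < length s" "s ! j = \<xi> ! (i - 1)"
    and le: "\<forall>k\<le>j. \<exists>i'\<le>i - 1. s ! k = \<xi> ! i'"
    using nths_index[OF i, of "{i. c i = s}"] s(2) unfolding s_def by auto
  note ev = session_event[OF s(1) assms(2) j(1)]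
  show "wf_asrt G (recv \<xi> i)" "wf_asrt G (sent \<xi> i)"
    using ev j(2) unfolding recv_def sent_def by auto
  assume "y \<in> fv (sent \<xi> i)"
  then obtain m where "m \<le> j" "y \<in> fv (fst (snd (s ! m)))"
    using ev j(2) unfolding sent_def by auto
  then obtain i' where "i' \<le> i - 1" "y \<in> fv (fst (snd (\<xi> ! i')))"
    using le by auto
  \<comment> \<open>Events are numbered from 1 but stored from 0.\<close>
  then have "Suc i' \<in> {1..i}" "y \<in> fv (recv \<xi> (Suc i'))"
    using assms(3) unfolding recv_def by auto
  then show "\<exists>j\<in>{1..i}. y \<in> fv (recv \<xi> j)" by blast
qed

lemma run_knowledge:
  assumes "run G Ag I Pr X \<xi> \<sigma> k" "I \<in> Ag" "i \<le> length \<xi>"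
  shows "k i I = (X I \<union> (\<Union>l\<in>{1..i}. pubs G (sent \<xi> l)), sent \<xi> ` {1..i})"
  using assms(3)
proof (induction i)
  case 0
  then show ?case using assms(1,2) unfolding run_def by auto
next
  case (Suc i)
  have "k (Suc i) I = update G (k (Suc i - 1) I) (sent \<xi> (Suc i))"
    using assms(1) Suc.prems unfolding run_def by force
  moreover have "{1..Suc i} = insert (Suc i) {1..i}" by auto
  ultimately show ?case using Suc by (simp add: update_def Un_ac)
qed

lemma fv_events: "i \<in> {1..length \<xi>} \<Longrightarrow> fv (recv \<xi> i) \<union> fv (sent \<xi> i) \<subseteq> events_fv \<xi>"
  using nth_mem[of "i - 1" \<xi>] unfolding events_fv_def recv_def sent_def by fastforce


section \<open>Typed proofs\<close>

text \<open>Surgery on a normal proof, from the leaves on. Conclusions of axioms and destructors are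
  subterms of \<open>X\<close>; where one of them is untyped, its subproof is exchanged for the
  constructor step that \<open>new\<close> provides, which is typed whatever its conclusion.\<close>

lemma typed_normal_proof:
  assumes wf: "wf_dy_theory G" "\<forall>s\<in>X. wf_trm G s"
    and new: "\<And>t. t \<in> (\<Union>s\<in>X. st s) \<Longrightarrow> t \<notin> tsubst \<sigma> ` D \<union> Var ` qvars G \<Longrightarrow>
      \<exists>f qs. length qs = arity G f \<and> t = Fun f (map concl qs) \<and>
        (\<forall>q\<in>set qs. valid G X q \<and> normal q \<and> typed G \<sigma> D q)"
    and "dy G X t"
  shows "\<exists>\<pi>. proves G X \<pi> t \<and> normal \<pi> \<and> typed G \<sigma> D \<pi>"
proof -
  have new': "\<exists>\<pi>. valid G X \<pi> \<and> concl \<pi> = t \<and> normal \<pi> \<and> typed G \<sigma> D \<pi>"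
    if t: "t \<in> (\<Union>s\<in>X. st s)" "t \<notin> tsubst \<sigma> ` D \<union> Var ` qvars G" for t
  proof -
    from new[OF t] obtain f qs where "length qs = arity G f" "t = Fun f (map concl qs)"
      "\<forall>q\<in>set qs. valid G X q \<and> normal q \<and> typed G \<sigma> D q" by blast
    then show ?thesis by (intro HOL.exI[of _ "Con f qs"]) auto
  qed
  have "valid G X \<pi> \<Longrightarrow> normal \<pi> \<Longrightarrow>
      \<exists>\<pi>'. valid G X \<pi>' \<and> concl \<pi>' = concl \<pi> \<and> normal \<pi>' \<and> typed G \<sigma> D \<pi>'" for \<pi>
  proof (induction \<pi>)
    case (Axm t)
    show ?case
    proof (cases "t \<in> tsubst \<sigma> ` D \<union> Var ` qvars G")
      case True
      then show ?thesis using Axm by (intro HOL.exI[of _ "Axm t"]) auto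
    next
      case False
      moreover have "t \<in> (\<Union>s\<in>X. st s)" using Axm st_refl by fastforce
      ultimately show ?thesis using new' by simp
    qed
  next
    case (Con f ps)
    then have "\<forall>q\<in>set ps. \<exists>q'. valid G X q' \<and> concl q' = concl q \<and> normal q' \<and> typed G \<sigma> D q'" by simp
    then obtain g where "\<forall>q\<in>set ps. valid G X (g q) \<and> concl (g q) = concl q \<and> normal (g q) \<and> typed G \<sigma> D (g q)"
      by metis
    then show ?case using Con.prems(1) by (intro HOL.exI[of _ "Con f (map g ps)"]) auto
  next
    case (Des t p ps)
    show ?case
    proof (cases "t \<in> tsubst \<sigma> ` D \<union> Var ` qvars G")
      case False
      moreover have "concl (Des t p ps) \<in> (\<Union>s\<in>X. st s)"
        by (rule normal_nonCon_concl[OF wf Des.prems]) simp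
      ultimately show ?thesis using new' by simp
    next
      case True
      obtain p' where p': "valid G X p'" "concl p' = concl p" "normal p'" "typed G \<sigma> D p'"
        using Des by auto
      have "\<forall>q\<in>set ps. \<exists>q'. valid G X q' \<and> concl q' = concl q \<and> normal q' \<and> typed G \<sigma> D q'"
        using Des by simp
      then obtain g where g: "\<forall>q\<in>set ps. valid G X (g q) \<and> concl (g q) = concl q \<and> normal (g q) \<and> typed G \<sigma> D (g q)"
        by metis
      from Des.prems(1) obtain f ts us j \<tau> where
        r: "(f, ts, us, j) \<in> drules G" "concl p = Fun f (map (inst \<tau>) ts)"
           "map concl ps = map (inst \<tau>) us" "t = inst \<tau> (ts ! j)"
        unfolding valid.simps by blast
      show ?thesis
      proof (cases p')
        \<comment> \<open>The rewritten major premise ends in a constructor. Its \<open>j\<close>-th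
          argument already is a typed normal proof of \<open>t\<close> and replaces the whole
          redex.\<close>
        case (Con f' qs)
        have j: "j < length ts" using wf(1) r(1) unfolding wf_dy_theory_def by auto
        have m: "map concl qs = map (inst \<tau>) ts" using Con p'(2) r(2) by simp
        then have len: "length qs = length ts" by (rule map_eq_imp_length_eq)
        then have "concl (qs ! j) = t" using arg_cong[OF m, of "\<lambda>xs. xs ! j"] j r(4) by simp
        moreover have "qs ! j \<in> set qs" using j len by simp
        ultimately show ?thesis using p' Con by (intro HOL.exI[of _ "qs ! j"]) auto
      next
        case (Axm u)
        have "map concl (map g ps) = map (inst \<tau>) us" using g r(3) by (simp cong: map_cong)
        then have "valid G X (Des t p' (map g ps))"
          unfolding valid.simps using r p' g by auto
        then show ?thesis using True p' g Axm by (intro HOL.exI[of _ "Des t p' (map g ps)"]) auto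
      next
        case (Des t' q qs)
        have "map concl (map g ps) = map (inst \<tau>) us" using g r(3) by (simp cong: map_cong)
        then have "valid G X (Des t p' (map g ps))"
          unfolding valid.simps using r p' g by auto
        then show ?thesis using True p' g Des by (intro HOL.exI[of _ "Des t p' (map g ps)"]) auto
      qed
    qed
  qed
  then show ?thesis using dy_normal[OF wf assms(4)] unfolding proves_def by metis
qed

theorem theorem3:
  fixes G :: "('f, 'n, 'v) dy_theory"
    and Ag :: "'n set" and I :: 'n
    and Pr :: "('f, 'n, 'v, 'p) role set"
    and X0 :: "'n \<Rightarrow> ('f, 'n, 'v) trm set"
    and \<xi> :: "('f, 'n, 'v, 'p) event list"
    and \<sigma> :: "('f, 'n, 'v) sbst"
    and k :: "('f, 'n, 'v, 'p) knowledge"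
    and X Y :: "nat \<Rightarrow> ('f, 'n, 'v, 'p) asrt set"
    and \<mu> \<theta> :: "nat \<Rightarrow> ('f, 'n, 'v) sbst"
  assumes "wf_dy_theory G"
    and "I \<in> Ag"
    and "protocol G Pr"
    and "run G Ag I Pr X0 \<xi> \<sigma> k"
    and "bound_renamed G \<xi>"
    and "\<And>i. i \<in> {1..length \<xi>} \<Longrightarrow>
           X i \<subseteq> hat (recv \<xi> i) \<and>
           dom (\<mu> i) = bv (recv \<xi> i) - (\<Union>\<gamma>\<in>X i. bv \<gamma>) \<and>
           (\<forall>x\<in>dom (\<mu> i). dy G (tsubst \<sigma> ` T_of I k (i - 1)) (the (\<mu> i x))) \<and>
           (\<forall>\<gamma>\<in>X i. deriv_eq G (ksubst \<sigma> (T_of I k (i - 1), E_of I k (i - 1)))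
                                (asubst \<sigma> (asubst (\<mu> i) \<gamma>)))"
    and "\<And>i. i \<in> {1..length \<xi>} \<Longrightarrow>
           Y i \<subseteq> hat (sent \<xi> i) \<and>
           dom (\<theta> i) = bv (sent \<xi> i) - (\<Union>\<gamma>\<in>Y i. bv \<gamma>) \<and>
           (\<forall>x\<in>dom (\<theta> i). dy G (tsubst \<sigma> ` U_of \<xi> k i) (the (\<theta> i x))) \<and>
           (\<forall>\<gamma>\<in>Y i. deriv_eq G (ksubst \<sigma> (U_of \<xi> k i, F_of \<xi> k i))
                                (asubst \<sigma> (asubst (\<theta> i) \<gamma>)))"
  shows "\<forall>t. \<forall>i\<in>{0..length \<xi>}. dy G (tsubst \<sigma> ` T_of I k i) t \<longrightarrow>
           (\<exists>\<pi>. proves G (tsubst \<sigma> ` T_of I k i) \<pi> t \<and> normal \<pi> \<and>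
                 typed G \<sigma> (D_of G I \<xi> k) \<pi>)"
proof -

  \<comment> \<open>Stages of the intruder's instantiated knowledge\<close>
  let ?n = "length \<xi>" and ?D = "D_of G I \<xi> k" and ?Q = "Var ` qvars G :: ('f, 'n, 'v) trm set"
  define T where "T i = tsubst \<sigma> ` T_of I k i" for i
  \<comment> \<open>Unlike \<open>T\<close>, \<open>S\<close> leaves out the variables bound in sent
    assertions. It is ground, and it is the term part of the knowledge from which received
    assertions are derived.\<close>
  define S where "S i = tsubst \<sigma> ` fst (k i I)" for i
  have X0: "vars t = {}" "wf_trm G t" if "t \<in> X0 I" for t
    using assms(2,4) that unfolding run_def by blast+
  have dom\<sigma>: "dom \<sigma> = events_fv \<xi>" and ran\<sigma>: "\<And>t. t \<in> ran \<sigma> \<Longrightarrow> vars t = {} \<and> wf_trm G t"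
    using assms(4) unfolding run_def by blast+
  have disj: "dom \<sigma> \<inter> qvars G = {}" using dom\<sigma> assms(5) unfolding bound_renamed_def by simp
  have img: "vars (tsubst \<sigma> (Var y)) = {}" "wf_trm G (tsubst \<sigma> (Var y))" if "y \<in> events_fv \<xi>" for y
  proof -
    have "y \<in> dom \<sigma>" using that dom\<sigma> by simp
    then obtain t where "\<sigma> y = Some t" using domD by metis
    then show "vars (tsubst \<sigma> (Var y)) = {}" "wf_trm G (tsubst \<sigma> (Var y))"
      using ran\<sigma>[of t] ranI[of \<sigma> y t] by simp_all
  qed
  note ev = run_event[OF assms(4,3)]
  have kn: "fst (k i I) = X0 I \<union> (\<Union>l\<in>{1..i}. pubs G (sent \<xi> l))" "snd (k i I) = sent \<xi> ` {1..i}"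
    if "i \<le> ?n" for i
    using run_knowledge[OF assms(4,2) that] by simp_all
  have T_eq: "T_of I k i = X0 I \<union> (\<Union>l\<in>{1..i}. pubs G (sent \<xi> l)) \<union> Var ` (\<Union>l\<in>{1..i}. bv (sent \<xi> l))"
    if "i \<le> ?n" for i
    using kn[OF that] by (simp add: T_of_def ker_def)
  have pk: "arity G (pkop G) = 1" using assms(1)[unfolded wf_dy_theory_def] by (rule conjunct1)
  have known: "vars (tsubst \<sigma> s) = {}" "wf_trm G (tsubst \<sigma> s)" if i: "i \<le> ?n" and s: "s \<in> fst (k i I)" for i s
  proof -
    consider "s \<in> X0 I" | l where "l \<in> {1..?n}" "s \<in> pubs G (sent \<xi> l)"
      using s i unfolding kn(1)[OF i] by fastforce
    then have *: "wf_trm G s \<and> vars s \<subseteq> events_fv \<xi>"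
    proof cases
      case 1
      then show ?thesis using X0 by simp
    next
      case 2
      note wfl = ev(2)[OF 2(1)]
      show ?thesis using pubs_wf[OF pk 2(2) wfl] pubs_vars[OF 2(2) wfl] fv_events[OF 2(1)] by blast
    qed
    show "vars (tsubst \<sigma> s) = {}" unfolding vars_tsubst[of \<sigma> s] using img(1) * by blast
    show "wf_trm G (tsubst \<sigma> s)" by (rule wf_tsubst) (use * img(2) in blast)+
  qed
  have ker: "T i \<subseteq> S i \<union> ?Q" "S i \<subseteq> T i" if "i \<le> ?n" for i
  proof -
    have "bv (sent \<xi> l) \<subseteq> qvars G" if "l \<in> {1..i}" for l
      using wf_bv ev(2)[of l] that \<open>i \<le> ?n\<close> by auto
    moreover have "tsubst \<sigma> (Var x) = Var x" if "x \<in> qvars G" for x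
      using that disj by (auto split: option.split)
    ultimately show "T i \<subseteq> S i \<union> ?Q"
      unfolding T_def S_def T_eq[OF that] kn(1)[OF that] by (fastforce simp del: tsubst_simps)
    show "S i \<subseteq> T i" unfolding T_def S_def T_eq[OF that] kn(1)[OF that] by blast
  qed
  have T_wf: "\<forall>s\<in>T i. wf_trm G s" if "i \<le> ?n" for i
    using ker(1)[OF that] known(2)[OF that] unfolding S_def by auto
  have T_mono: "T i \<subseteq> T j" if "i \<le> j" "j \<le> ?n" for i j
  proof -
    have "{1..i} \<subseteq> {1..j}" "i \<le> ?n" using that by auto
    then show ?thesis unfolding T_def T_eq[OF that(2)] T_eq[OF \<open>i \<le> ?n\<close>] by blast
  qed

  \<comment> \<open>Terms inside the value of a variable received so far. The next facts show that a
    ground subterm of the intruder's knowledge outside \<sigma>(D) is of this kind.\<close>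
  let ?old = "\<lambda>i t. \<exists>l\<in>{1..i}. \<exists>y\<in>fv (recv \<xi> l). t \<in> st (tsubst \<sigma> (Var y))"
  have old_sent: "?old i t"
    if i: "i \<le> ?n" and l: "l \<in> {1..i}" and y: "y \<in> fv (sent \<xi> l)" "t \<in> st (tsubst \<sigma> (Var y))" for i l y t
  proof -
    obtain j where j: "j \<in> {1..l}" "y \<in> fv (recv \<xi> j)" using ev(3)[of l y] i l y(1) by auto
    then have "j \<in> {1..i}" using l by auto
    then show ?thesis using j(2) y(2) by blast
  qed
  have old_S: "?old i t" if i: "i \<le> ?n" and t: "t \<in> (\<Union>s\<in>S i. st s)" "t \<notin> tsubst \<sigma> ` ?D" for i t
  proof -
    obtain s where s: "s \<in> fst (k i I)" "t \<in> st (tsubst \<sigma> s)" using t(1) unfolding S_def by auto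
    from s(2) show ?thesis
    proof (cases rule: st_tsubst_cases)
      case (1 v)
      have "s \<in> T_of I k i" using s(1) unfolding T_eq[OF i] kn(1)[OF i] by blast
      then have "v \<in> ?D" using 1 i unfolding D_of_def C_of_def by auto
      then show ?thesis using 1 t(2) by blast
    next
      case (2 y)
      \<comment> \<open>Initial knowledge is ground, so a term containing \<open>y\<close> was
        sent.\<close>
      then have "s \<notin> X0 I" using X0 by auto
      then obtain l where "l \<in> {1..i}" "s \<in> pubs G (sent \<xi> l)"
        using s(1) unfolding kn(1)[OF i] by blast
      moreover from this have "y \<in> fv (sent \<xi> l)" using pubs_vars ev(2) i 2(1) by fastforce
      ultimately show ?thesis using old_sent i 2(2) by blast
    qed
  qed
  have old_E: "?old i t"
    if i: "i \<le> ?n" and l: "l \<in> {1..i}"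
      and t: "t \<in> ast G (asubst \<sigma> (sent \<xi> l))" "vars t = {}" "t \<notin> tsubst \<sigma> ` ?D" for i l t
  proof -
    have wfl: "wf_asrt G (sent \<xi> l)" using ev(2) i l by simp
    consider u where "u \<in> ast G (sent \<xi> l)" "u \<notin> range Var" "t = tsubst \<sigma> u"
      | y where "y \<in> fv (sent \<xi> l)" "t \<in> st (tsubst \<sigma> (Var y))"
      using ast_asubst_cases[OF t(1,2) wfl disj] by blast
    then show ?thesis
    proof cases
      case 1
      obtain c where "c \<in> atoms (sent \<xi> l)" "u \<in> ast G c" using ast_atoms[OF 1(1,2)] by blast
      moreover from this have "c \<in> E_of I k i" unfolding E_of_def ker_def using kn(2)[OF i] l by auto
      ultimately have "u \<in> ?D" using 1(2) i unfolding D_of_def C_of_def by auto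
      then show ?thesis using 1(3) t(3) by blast
    next
      case 2
      then show ?thesis using old_sent i l by blast
    qed
  qed

  have fresh: "\<exists>j<i. dy G (S j) t \<and> t \<notin> (\<Union>s\<in>S j. st s)"
    if i: "i \<le> ?n" and t: "?old i t" "t \<notin> tsubst \<sigma> ` ?D" for i t
  proof -
    let ?P = "\<lambda>l. l \<in> {1..i} \<and> (\<exists>y\<in>fv (recv \<xi> l). t \<in> st (tsubst \<sigma> (Var y)))"
    \<comment> \<open>Event \<open>m\<close> is the first to receive a variable whose value contains
      \<open>t\<close>; \<open>j = m - 1\<close> is the intruder's stage when deriving that
      assertion, and there \<open>t\<close> is not yet old.\<close>
    define m where "m = (LEAST l. ?P l)"
    have "\<exists>l. ?P l" using t(1) by blast
    then have m: "?P m" unfolding m_def by (rule LeastI_ex)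
    have min: "\<not> ?P l" if "l < m" for l using not_less_Least that unfolding m_def by blast
    define j where "j = m - 1"
    have j: "m = Suc j" "j < i" "j \<le> ?n" using m i unfolding j_def by auto
    have not_old: "\<not> ?old j t"
    proof
      assume "?old j t"
      then obtain l where "l \<in> {1..j}" "\<exists>y\<in>fv (recv \<xi> l). t \<in> st (tsubst \<sigma> (Var y))" by blast
      then show False using min[of l] j by auto
    qed
    obtain y where y: "y \<in> fv (recv \<xi> m)" "t \<in> st (tsubst \<sigma> (Var y))" using m by blast
    have m': "m \<in> {1..?n}" using m i by auto
    have "y \<in> events_fv \<xi>" using fv_events[OF m'] y(1) by blast
    then have ground: "vars t = {}" using img(1) st_vars[OF y(2)] by blast
    have recv: "t \<in> ast G (asubst \<sigma> (recv \<xi> m))" using st_fv_ast[OF y(1) ev(1)[OF m'] disj] y(2) by blast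
    have der: "aderiv G True (S j) (asubst \<sigma> ` sent \<xi> ` {1..j}) (asubst \<sigma> (recv \<xi> m))"
    proof -
      have "deriv_a G (ksubst \<sigma> (k (m - 1) I)) (asubst \<sigma> (recv \<xi> m))"
        using assms(4) m' unfolding run_def by blast
      then show ?thesis unfolding ksubst_def S_def j(1) using kn(2)[OF j(3)] by simp
    qed
    \<comment> \<open>\<open>?M\<close> collects the subterms of \<open>?Z\<close> and of the
      assertions known at stage \<open>j\<close>, so a ground term outside it is new to the
      intruder.\<close>
    let ?Z = "S j \<union> ?Q"
    let ?M = "(\<Union>s\<in>?Z. st s) \<union> (\<Union>a\<in>asubst \<sigma> ` sent \<xi> ` {1..j}. ast G a)"
    have wfZ: "\<forall>s\<in>?Z. wf_trm G s" using known(2)[OF j(3)] unfolding S_def by auto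
    have groundS: "\<forall>s\<in>S j. vars s = {}" using known(1)[OF j(3)] unfolding S_def by auto
    have "sides_derivable G ?Z (asubst \<sigma> (sent \<xi> l))" if "l \<in> {1..j}" for l
    proof (rule sides_derivable_pubs)
      show "wf_asrt G (sent \<xi> l)" using ev(2) that j(3) by simp
      show "tsubst \<sigma> ` pubs G (sent \<xi> l) \<subseteq> ?Z" unfolding S_def kn(1)[OF j(3)] using that by blast
    qed (use disj in auto)
    then have A: "sides_derivable G ?Z a \<and> (\<forall>u\<in>ast G a. vars u = {} \<longrightarrow> u \<in> ?M \<or> dy G ?Z u)"
      if "a \<in> asubst \<sigma> ` sent \<xi> ` {1..j}" for a
      using that by blast
    have ren: "tsubst [x \<mapsto> Var z] u \<in> ?Z" if z: "z \<in> qvars G" and u: "u \<in> ?Z" for x z u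
    proof (cases "u \<in> S j")
      case True
      then show ?thesis using groundS by (simp add: tsubst_single_ident del: fun_upd_apply)
    next
      case False
      then obtain w where "u = Var w" "w \<in> qvars G" using u by blast
      then show ?thesis using z by (cases "w = x") simp_all
    qed
    have "sides_derivable G ?Z (asubst \<sigma> (recv \<xi> m)) \<and>
        (\<forall>u\<in>ast G (asubst \<sigma> (recv \<xi> m)). vars u = {} \<longrightarrow> u \<in> ?M \<or> dy G ?Z u)"
      by (rule aderiv_terms[OF der assms(1) wfZ ren _ _ _ A]) blast+
    then have "t \<in> ?M \<or> dy G ?Z t" using recv ground by blast
    \<comment> \<open>Each part of \<open>?M\<close> is excluded in turn, which leaves only
      derivability of \<open>t\<close>.\<close>
    moreover have S: "t \<notin> (\<Union>s\<in>S j. st s)" using old_S[OF j(3) _ t(2)] not_old by blast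
    moreover have "t \<notin> (\<Union>a\<in>asubst \<sigma> ` sent \<xi> ` {1..j}. ast G a)"
      using old_E[OF j(3) _ _ ground t(2)] not_old by blast
    moreover have "t \<notin> (\<Union>s\<in>?Q. st s)" using ground by auto
    ultimately have "dy G ?Z t" unfolding UN_Un Un_iff by meson
    then have "dy G (S j) t" using dy_ground_drop_vars[OF assms(1) groundS _ ground] by blast
    then show ?thesis using S j(2) by blast
  qed

  have main: "i \<le> ?n \<Longrightarrow> dy G (T i) t \<Longrightarrow> \<exists>\<pi>. proves G (T i) \<pi> t \<and> normal \<pi> \<and> typed G \<sigma> ?D \<pi>" for i t
  \<comment> \<open>Strong induction on the stage: \<open>fresh\<close> always leads to a strictly
    earlier one.\<close>
  proof (induction i arbitrary: t rule: less_induct)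
    case (less i)
    show ?case
    proof (rule typed_normal_proof[OF assms(1) T_wf[OF less.prems(1)] _ less.prems(2)])
      fix u assume u: "u \<in> (\<Union>s\<in>T i. st s)" "u \<notin> tsubst \<sigma> ` ?D \<union> ?Q"
      then have "u \<in> (\<Union>s\<in>S i. st s)" using ker(1)[OF less.prems(1)] by fastforce
      then have "?old i u" using old_S[OF less.prems(1)] u(2) by blast
      then obtain j where j: "j < i" "dy G (S j) u" "u \<notin> (\<Union>s\<in>S j. st s)"
        using fresh[OF less.prems(1)] u(2) by blast
      have jn: "j \<le> ?n" using j(1) less.prems(1) by simp
      have wfS: "\<forall>s\<in>S j. wf_trm G s" using T_wf[OF jn] ker(2)[OF jn] by blast
      obtain \<pi> where \<pi>: "valid G (S j) \<pi>" "concl \<pi> = u" "normal \<pi>"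
        using dy_normal[OF assms(1) wfS j(2)] .
      \<comment> \<open>As \<open>u\<close> is no subterm of \<open>S j\<close>, a normal proof of
        it cannot end in an axiom or a destructor.\<close>
      then have "is_Con \<pi>" using normal_nonCon_concl[OF assms(1) wfS] j(3) by blast
      then obtain f ps where ps: "\<pi> = Con f ps" by (cases \<pi>) auto
      have "\<exists>q'. valid G (T i) q' \<and> concl q' = concl q \<and> normal q' \<and> typed G \<sigma> ?D q'" if "q \<in> set ps" for q
      proof -
        have "dy G (S j) (concl q)" using \<pi>(1) ps that unfolding dy_def proves_def by auto
        \<comment> \<open>The arguments are derivable at the earlier stage \<open>j\<close>, where
          the induction hypothesis types them. The typed proofs carry over to \<open>T i\<close>
          because knowledge grows and \<open>?D\<close> is the same at all stages.\<close>
        then have "dy G (T j) (concl q)" using dy_mono ker(2)[OF jn] by blast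
        then obtain q' where "proves G (T j) q' (concl q)" "normal q'" "typed G \<sigma> ?D q'"
          using less.IH[OF j(1) jn] by blast
        then show ?thesis
          using valid_mono T_mono[of j i] j(1) less.prems(1) unfolding proves_def by (meson less_imp_le)
      qed
      then obtain g where "\<forall>q\<in>set ps. valid G (T i) (g q) \<and> concl (g q) = concl q \<and> normal (g q) \<and> typed G \<sigma> ?D (g q)"
        by metis
      then show "\<exists>f qs. length qs = arity G f \<and> u = Fun f (map concl qs) \<and>
          (\<forall>q\<in>set qs. valid G (T i) q \<and> normal q \<and> typed G \<sigma> ?D q)"
        using \<pi>(1,2) ps by (intro HOL.exI[of _ f] HOL.exI[of _ "map g ps"]) auto
    qed
  qed
  then show ?thesis unfolding T_def by simp
qed

end
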